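(* Let $f:[a,b]\times\mathcal{Z}\to[a,b]$ be measurable and monotone increasing in the first argument, and let $X_{t+1}=f(X_t,Z_t)$, $t=0,1,\ldots$, with $X_0\in[a,b]$. Assume that $\{Z_t\}$ is an aperiodic time-homogeneous Markov chain on a countable state space $\mathcal{Z}$ with a positive recurrent atom at a point $z_0$. Assume also that there exist a number $a\le c\le b$, positive integers $N_1$ and $N_2$, and sequences $z_{1,1},\ldots,z_{N_1,1}$ and $z_{1,2},\ldots,z_{N_2,2}$ in $\mathcal{Z}$ such that $z_{N_1,1}=z_{N_2,2}=z_0$ and, for $i=1,2$, $$p_i:=\mathbf{P}(Z_j=z_{j,i}\ \text{for } j=1,\ldots,N_i\mid Z_0=z_0)>0,$$ and that $$\delta_1:=\mathbf{P}\bigl(\widetilde X^{(b)}_{N_1}\le c\mid Z_0=z_0,\ Z_j=z_{j,1},\ j=1,\ldots,N_1\bigr)>0$$ and $$\delta_2:=\mathbf{P}\bigl(\widetilde X^{(a)}_{N_2}\ge c\mid Z_0=z_0,\ Z_j=z_{j,2},\ j=1,\ldots,N_2\bigr)>0.$$ Then the distribution of $X_t$ converges in the uniform metric to a unique stationary distribution. In addition, there exists a stationary sequence $(X^t,Z^t)$ such that, as $t\to\infty$, $$\sup_{a\le x\le b}\ \sup_{B\in\mathcal{B}_{\mathcal{Z}}}\bigl|\mathbf{P}(X_t\le x,Z_t\in B)-\mathbf{P}(X^t\le x,Z^t\in B)\bigr|\to 0.$$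
   Context: The state space of $X$ is a closed interval $[a,b]\subset\mathbb{R}$, $a<b$; $\mathcal{B}_{\mathcal{Z}}$ is the $\sigma$-algebra on $\mathcal{Z}$ (all subsets, $\mathcal{Z}$ being countable). Monotone increasing in the first argument: for each $z\in\mathcal{Z}$ and $a\le x_1\le x_2\le b$, $f(x_1,z)\le f(x_2,z)$. Positive recurrent atom at $z_0$: for any $z\in\mathcal{Z}$, the first hitting time $T_1^z=\min\{t\ge 1: Z_t=z_0\}$ of the chain started from $Z_0=z$ is finite almost surely, and $\mathbf{E}T_1^{z_0}<\infty$. Aperiodicity means $\mathrm{G.C.D.}\{n:\mathbf{P}(T_1^{z_0}=n)>0\}=1$. Auxiliary process: for $\alpha\in[a,b]$ and the chain started at $Z_0=z_0$, $\widetilde X_0^{(\alpha)}=\alpha$ and $\widetilde X^{(\alpha)}_{t+1}=f(\widetilde X^{(\alpha)}_t,Z_t)$, $t\ge 0$. Uniform metric between distributions on the real line with distribution functions $F,G$: $d(F,G)=\sup_x|F(x)-G(x)|$. "Unique stationary distribution" for $X_t$ means a unique limiting distribution, the same for any initial value of the process. A sequence is stationary if its finite-dimensional distributions are invariant under time shifts. *)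

theory Defs
  imports "HOL-Probability.Probability"
begin

definition markov_chain ::
  "'w measure \<Rightarrow> ('z::countable \<Rightarrow> 'z pmf) \<Rightarrow> (nat \<Rightarrow> 'w \<Rightarrow> 'z) \<Rightarrow> bool" where
  "markov_chain M K Z \<longleftrightarrow>
     prob_space M \<and>
     (\<forall>t. Z t \<in> M \<rightarrow>\<^sub>M count_space UNIV) \<and>
     (\<forall>t z. \<P>(\<omega> in M. \<forall>s\<le>t. Z s \<omega> = z s) > 0 \<longrightarrow>
        \<P>(\<omega> in M. Z (Suc t) \<omega> = z (Suc t) \<bar> \<forall>s\<le>t. Z s \<omega> = z s) = pmf (K (z t)) (z (Suc t)))"

fun chain_step :: "('z::countable \<Rightarrow> 'z pmf) \<Rightarrow> 'z \<Rightarrow> nat \<Rightarrow> (nat \<Rightarrow> 'z) \<Rightarrow> 'z measure" where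
  "chain_step K z 0 \<omega> = measure_pmf (return_pmf z)"
| "chain_step K z (Suc n) \<omega> = measure_pmf (K (\<omega> n))"

(* The law, on the space of paths, of the chain with transition kernel K started at z. The lemmas
   chain_law_start and markov_chain_chain_law below confirm this. *)
definition chain_law :: "('z::countable \<Rightarrow> 'z pmf) \<Rightarrow> 'z \<Rightarrow> (nat \<Rightarrow> 'z) measure" where
  "chain_law K z =
     projective_family.lim UNIV
       (Ionescu_Tulcea.CI (chain_step K z) (\<lambda>_. count_space UNIV)) (\<lambda>_. count_space UNIV)"

lemma Ionescu_Tulcea_chain_step:
  fixes K :: "'a::countable \<Rightarrow> 'a pmf"
  shows "Ionescu_Tulcea (chain_step K z) (\<lambda>_. count_space UNIV)"
proof (rule Ionescu_Tulcea.intro)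
  fix i
  show "chain_step K z i \<in>
      Pi\<^sub>M {0..<i} (\<lambda>_. count_space UNIV) \<rightarrow>\<^sub>M subprob_algebra (count_space UNIV)"
  proof (cases i)
    case 0
    then have "chain_step K z i = (\<lambda>_. measure_pmf (return_pmf z))"
      by auto
    then show ?thesis
      by (simp add: space_subprob_algebra measure_pmf.subprob_space_axioms)
  next
    case (Suc n)
    have "(\<lambda>\<omega>. measure_pmf (K (\<omega> n))) \<in>
        Pi\<^sub>M {0..<i} (\<lambda>_. count_space UNIV) \<rightarrow>\<^sub>M subprob_algebra (count_space UNIV)"
      by (rule measurable_compose[OF measurable_component_singleton])
        (auto simp: Suc space_subprob_algebra measure_pmf.subprob_space_axioms)
    moreover have "chain_step K z i = (\<lambda>\<omega>. measure_pmf (K (\<omega> n)))"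
      by (auto simp: Suc)
    ultimately show ?thesis by simp
  qed
next
  fix i :: nat and x :: "nat \<Rightarrow> 'a"
  show "prob_space (chain_step K z i x)"
    by (cases i) (auto simp: measure_pmf.prob_space_axioms)
qed

lemma sets_chain_law: "sets (chain_law K z) = sets (Pi\<^sub>M UNIV (\<lambda>_. count_space UNIV))"
proof -
  interpret Ionescu_Tulcea "chain_step K z" "\<lambda>_. count_space UNIV"
    by (rule Ionescu_Tulcea_chain_step)
  show ?thesis by (simp add: chain_law_def PF.sets_lim)
qed

lemma space_chain_law [simp]: "space (chain_law K z) = UNIV"
  using sets_eq_imp_space_eq[OF sets_chain_law] by (simp add: space_PiM)

lemma prob_space_chain_law: "prob_space (chain_law K z)"
proof -
  interpret Ionescu_Tulcea "chain_step K z" "\<lambda>_. count_space UNIV"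
    by (rule Ionescu_Tulcea_chain_step)
  have "emeasure PF.lim (PF.emb UNIV {} {\<lambda>x. undefined}) = emeasure (CI {}) {\<lambda>x. undefined}"
    by (rule lim) (auto simp: PiM_empty)
  also have "\<dots> = 1"
    using prob_space.emeasure_space_1[OF PF.prob_space_P[of "{}"]]
    by (simp add: PF.space_P space_PiM)
  also have "PF.emb UNIV {} {\<lambda>x. undefined} = UNIV"
    by (auto simp: prod_emb_def fun_eq_iff space_PiM)
  finally show ?thesis
    using space_chain_law[of K z] by (intro prob_spaceI) (simp add: chain_law_def)
qed

lemma emeasure_chain_law_cylinder:
  fixes K :: "'z::countable \<Rightarrow> 'z pmf"
  shows "emeasure (chain_law K z) {\<omega>. \<forall>s<n. \<omega> s = \<zeta> s} =
    (\<Prod>s<n. emeasure (chain_step K z s \<zeta>) {\<zeta> s})"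
proof -
  interpret Ionescu_Tulcea "chain_step K z" "\<lambda>_. count_space UNIV"
    by (rule Ionescu_Tulcea_chain_step)
  define A where "A n = {restrict \<zeta> {0..<n}}" for n
  have A_sets: "A n \<in> sets (Pi\<^sub>M {0..<n} (\<lambda>_. count_space UNIV))" for n
  proof -
    have "A n = Pi\<^sub>E {0..<n} (\<lambda>s. {\<zeta> s})"
      by (auto simp: A_def PiE_def extensional_def fun_eq_iff Pi_iff)
    then show ?thesis by (auto intro!: sets_PiM_I_finite)
  qed
  let ?u = "\<lambda>x::nat. undefined :: 'z"
  have u: "?u \<in> space (Pi\<^sub>M {0..<0} (\<lambda>_. count_space UNIV))" by (simp add: space_PiM)
  have C: "emeasure (C 0 n ?u) (A n) = (\<Prod>s<n. emeasure (chain_step K z s \<zeta>) {\<zeta> s})" for n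
  proof (induction n)
    case 0
    show ?case by (simp add: A_def PiM_empty emeasure_return restrict_def)
  next
    case (Suc n)
    have sp: "space (C 0 n ?u) = space (Pi\<^sub>M {0..<n} (\<lambda>_. count_space UNIV))"
      using space_C[OF u, of n] by simp
    have st: "sets (C 0 n ?u) = sets (Pi\<^sub>M {0..<n} (\<lambda>_. count_space UNIV))"
      using sets_C[OF u, of n] by simp
    have ne: "space (C 0 n ?u) \<noteq> {}"
      using prob_space.not_empty[OF prob_space_C[OF u]] .
    have mem: "eP n \<in> C 0 n ?u \<rightarrow>\<^sub>M subprob_algebra (Pi\<^sub>M {0..<Suc n} (\<lambda>_. count_space UNIV))"
      using measurable_eP[of n] by (simp add: measurable_cong_sets[OF st refl])
    have "emeasure (C 0 (Suc n) ?u) (A (Suc n)) =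
        (\<integral>\<^sup>+\<omega>. emeasure (eP n \<omega>) (A (Suc n)) \<partial>C 0 n ?u)"
      using emeasure_bind[OF ne mem A_sets] by simp
    also have "\<dots> = (\<integral>\<^sup>+\<omega>. emeasure (chain_step K z n \<zeta>) {\<zeta> n} * indicator (A n) \<omega> \<partial>C 0 n ?u)"
    proof (rule nn_integral_cong)
      fix \<omega> assume "\<omega> \<in> space (C 0 n ?u)"
      then have \<omega>: "\<omega> \<in> space (Pi\<^sub>M {0..<n} (\<lambda>_. count_space UNIV))" by (simp add: sp)
      then have ext: "\<omega> \<in> extensional {0..<n}" by (simp add: space_PiM PiE_def)
      have e: "emeasure (eP n \<omega>) (A (Suc n)) =
          emeasure (chain_step K z n \<omega>) ((\<lambda>x. fun_upd \<omega> n x) -` A (Suc n) \<inter> UNIV)"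
        using emeasure_eP[OF \<omega> A_sets] by simp
      show "emeasure (eP n \<omega>) (A (Suc n)) =
          emeasure (chain_step K z n \<zeta>) {\<zeta> n} * indicator (A n) \<omega>"
      proof (cases "\<omega> \<in> A n")
        case True
        then have w: "\<omega> = restrict \<zeta> {0..<n}" by (simp add: A_def)
        have "(\<lambda>x. fun_upd \<omega> n x) -` A (Suc n) = {\<zeta> n}"
          by (auto simp: A_def w fun_eq_iff restrict_def split: if_splits)
        moreover have "chain_step K z n \<omega> = chain_step K z n \<zeta>"
          by (cases n) (auto simp: w)
        ultimately show ?thesis using True e by simp
      next
        case False
        have "(\<lambda>x. fun_upd \<omega> n x) -` A (Suc n) = {}"
        proof (rule ccontr)
          assume "\<not> ?thesis"
          then obtain x where x: "fun_upd \<omega> n x = restrict \<zeta> {0..<Suc n}" by (auto simp: A_def)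
          have "\<omega> s = restrict \<zeta> {0..<n} s" for s
            using fun_cong[OF x, of s] ext
            by (cases "s < n") (auto simp: extensional_def split: if_splits)
          then have "\<omega> \<in> A n" by (auto simp: A_def)
          with False show False ..
        qed
        then show ?thesis using False e by simp
      qed
    qed
    also have "\<dots> = emeasure (chain_step K z n \<zeta>) {\<zeta> n} * emeasure (C 0 n ?u) (A n)"
      using A_sets by (simp add: nn_integral_cmult_indicator st)
    finally show ?case by (simp add: Suc mult.commute)
  qed
  have "emeasure PF.lim (PF.emb UNIV {0..<n} (A n)) = emeasure (CI {0..<n}) (A n)"
    by (rule lim) (auto simp: A_sets)
  also have "\<dots> = emeasure (C 0 n ?u) (PF.emb {0..<n} {0..<n} (A n))"
    by (rule emeasure_CI) (auto simp: A_sets)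
  also have "PF.emb {0..<n} {0..<n} (A n) = A n"
    using sets.sets_into_space[OF A_sets[of n]] by (intro prod_emb_id) (simp add: space_PiM)
  also have "PF.emb UNIV {0..<n} (A n) = {\<omega>. \<forall>s<n. \<omega> s = \<zeta> s}"
    by (auto simp: prod_emb_def A_def fun_eq_iff restrict_def space_PiM split: if_splits)
  finally show ?thesis by (simp add: chain_law_def C)
qed

lemma chain_law_start: "\<P>(\<omega> in chain_law K z. \<omega> 0 = z) = 1"
  using emeasure_chain_law_cylinder[of K z 1 "\<lambda>_. z"]
  by (simp add: measure_def emeasure_pmf_single)

lemma markov_chain_chain_law: "markov_chain (chain_law K z) K (\<lambda>t \<omega>. \<omega> t)"
  unfolding markov_chain_def
proof (intro conjI allI impI)
  show "prob_space (chain_law K z)" by (rule prob_space_chain_law)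
next
  fix t
  show "(\<lambda>\<omega>. \<omega> t) \<in> chain_law K z \<rightarrow>\<^sub>M count_space UNIV"
    unfolding measurable_cong_sets[OF sets_chain_law refl]
    by (rule measurable_component_singleton) simp
next
  fix t \<zeta>
  assume pos: "\<P>(\<omega> in chain_law K z. \<forall>s\<le>t. \<omega> s = \<zeta> s) > 0"
  have e: "\<P>(\<omega> in chain_law K z. \<forall>s<n. \<omega> s = \<zeta> s) =
      (\<Prod>s<n. measure (chain_step K z s \<zeta>) {\<zeta> s})" for n
  proof -
    have "emeasure (chain_step K z s \<zeta>) {\<zeta> s} = ennreal (measure (chain_step K z s \<zeta>) {\<zeta> s})" for s
      by (cases s) (simp_all add: measure_pmf.emeasure_eq_measure)
    then have "emeasure (chain_law K z) {\<omega>. \<forall>s<n. \<omega> s = \<zeta> s} =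
        ennreal (\<Prod>s<n. measure (chain_step K z s \<zeta>) {\<zeta> s})"
      using emeasure_chain_law_cylinder[of K z n \<zeta>] by (simp add: prod_ennreal)
    then show ?thesis
      by (simp add: Sigma_Algebra.measure_def[of "chain_law K z"] prod_nonneg)
  qed
  have "{\<omega>. \<omega> (Suc t) = \<zeta> (Suc t) \<and> (\<forall>s\<le>t. \<omega> s = \<zeta> s)} = {\<omega>. \<forall>s<Suc (Suc t). \<omega> s = \<zeta> s}"
    by (auto simp: less_Suc_eq_le le_Suc_eq)
  then show "\<P>(\<omega> in chain_law K z. \<omega> (Suc t) = \<zeta> (Suc t) \<bar> \<forall>s\<le>t. \<omega> s = \<zeta> s) =
      pmf (K (\<zeta> t)) (\<zeta> (Suc t))"
    using pos e[of "Suc t"] e[of "Suc (Suc t)"]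
    by (auto simp: cond_prob_def less_Suc_eq_le measure_pmf_single zero_less_mult_iff
             simp del: prod_zero_iff)
qed

(* The value is infinity if z0 is never visited at a time t >= 1, the infimum of the empty set. *)
definition hitting_time :: "'z \<Rightarrow> (nat \<Rightarrow> 'z) \<Rightarrow> enat" where
  "hitting_time z\<^sub>0 \<omega> = (INF t\<in>{t. 1 \<le> t \<and> \<omega> t = z\<^sub>0}. enat t)"

definition positive_recurrent_atom :: "('z::countable \<Rightarrow> 'z pmf) \<Rightarrow> 'z \<Rightarrow> bool" where
  "positive_recurrent_atom K z\<^sub>0 \<longleftrightarrow>
     (\<forall>z. AE \<omega> in chain_law K z. hitting_time z\<^sub>0 \<omega> < \<infinity>) \<and>
     (\<integral>\<^sup>+\<omega>. ennreal_of_enat (hitting_time z\<^sub>0 \<omega>) \<partial>chain_law K z\<^sub>0) < \<infinity>"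

definition aperiodic_at :: "('z::countable \<Rightarrow> 'z pmf) \<Rightarrow> 'z \<Rightarrow> bool" where
  "aperiodic_at K z\<^sub>0 \<longleftrightarrow>
     Gcd {n::nat. \<P>(\<omega> in chain_law K z\<^sub>0. hitting_time z\<^sub>0 \<omega> = enat n) > 0} = 1"

primrec aux_process :: "(real \<Rightarrow> 'z \<Rightarrow> real) \<Rightarrow> real \<Rightarrow> nat \<Rightarrow> (nat \<Rightarrow> 'z) \<Rightarrow> real" where
  "aux_process f \<alpha> 0 \<omega> = \<alpha>"
| "aux_process f \<alpha> (Suc t) \<omega> = f (aux_process f \<alpha> t \<omega>) (\<omega> t)"

definition uniform_dist :: "real measure \<Rightarrow> real measure \<Rightarrow> real" where
  "uniform_dist \<mu> \<nu> = (SUP x. \<bar>cdf \<mu> x - cdf \<nu> x\<bar>)"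

definition stationary_sequence :: "'s measure \<Rightarrow> 'a measure \<Rightarrow> (nat \<Rightarrow> 's \<Rightarrow> 'a) \<Rightarrow> bool" where
  "stationary_sequence S N Y \<longleftrightarrow>
     prob_space S \<and>
     (\<forall>t. Y t \<in> S \<rightarrow>\<^sub>M N) \<and>
     (\<forall>J k. finite J \<longrightarrow>
        distr S (Pi\<^sub>M J (\<lambda>_. N)) (\<lambda>s. \<lambda>j\<in>J. Y (j + k) s) =
        distr S (Pi\<^sub>M J (\<lambda>_. N)) (\<lambda>s. \<lambda>j\<in>J. Y j s))"

end

theory Submission
  imports Defs
begin

text \<open>
  Monotonicity reduces every question about \<open>X\<close> to the two extreme trajectories, those started at
  \<open>a\<close> and at \<open>b\<close> and driven by the same chain: any other trajectory stays between them. So it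
  suffices that the extreme trajectories become indistinguishable in distribution and that the law
  of one of them settles.

  \<^bold>\<open>Merging.\<close> For a lower set \<open>I\<close> of \<open>[a, b]\<close>, consider the probability, from \<open>z0\<close>, that at
  time \<open>t\<close> the trajectory from \<open>a\<close> is in \<open>I\<close>, the one from \<open>b\<close> is not, and the chain is at \<open>z\<close>. The
  steps along any path compose to a monotone map, which pulls lower sets back to lower sets.
  Hence the supremum of this probability over \<open>I\<close>, regarded as a measure in \<open>z\<close>, is at each time
  dominated by the image under the kernel of its predecessor, and its total mass never grows. At
  \<open>z0\<close> mass is lost: the two given words, concatenated in either order, lead from \<open>z0\<close> back to \<open>z0\<close>
  in the same time \<open>N\<close>; one order moves all of \<open>[a, b]\<close> into \<open>[a, c]\<close>, the other into \<open>[c, b]\<close>. A lower set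
  contains \<open>c\<close> or it does not, and accordingly one of the two orders leaves nothing to
  separate (lemma \<open>mass_contraction\<close>). Since the lost mass is at most the initial mass, the
  separation at \<open>z0\<close> is summable over time (\<open>summable_atom_sep\<close>). Cutting a path at its last visit to
  \<open>z0\<close> bounds the separation at an arbitrary state by the convolution of that summable
  sequence with the tail of the return time, which is summable because the mean return time
  is finite (\<open>separation_le\<close>, \<open>summable_sep_bound\<close>).

  \<^bold>\<open>Settling.\<close> Cutting a path at its first return to \<open>z0\<close> shows that the probability of
  \<open>X\<^sub>t \<in> I, Z\<^sub>t \<in> B\<close>, started from \<open>a\<close> and \<open>z0\<close>, solves a renewal equation up to a defect: after the
  return the trajectory is no longer at \<open>a\<close>, but by the first part this costs a summable amount
  that depends neither on \<open>I\<close> nor on \<open>B\<close>. The renewal theorem turns this into convergence,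
  uniformly in \<open>I\<close> and \<open>B\<close> (\<open>renewal_equation_uniform_limit\<close>, \<open>uniform_limit_from_atom\<close>). The first
  visit to \<open>z0\<close> transfers the limit to every initial law of the chain (\<open>uniform_limit_from_law\<close>),
  and the squeeze between the extreme trajectories transfers it to every \<open>X\<^sub>0\<close>
  (\<open>recursion_converges\<close>). Uniformity also makes the limit a genuine probability law
  (\<open>uniform_limit_of_laws\<close>). Repeating a single draw from this law gives a stationary sequence
  whose one-time law is the limit of the laws of \<open>(X\<^sub>t, Z\<^sub>t)\<close>.
\<close>

section \<open>Renewal equations\<close>

text \<open>The least positive difference of two elements divides every element, so it is 1 and the set
  contains two consecutive numbers; their nonnegative combinations exhaust all large numbers.\<close>

lemma Gcd_1_closed_contains_all_large:
  fixes S :: "nat set"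
  assumes zero: "0 \<in> S" and add: "\<And>x y. x \<in> S \<Longrightarrow> y \<in> S \<Longrightarrow> x + y \<in> S" and gcd: "Gcd S = 1"
  shows "\<exists>n0. \<forall>n\<ge>n0. n \<in> S"
proof -
  have mult: "k * x \<in> S" if "x \<in> S" for k x
    by (induction k) (auto simp: zero add that)
  define P where "P d \<longleftrightarrow> 0 < d \<and> (\<exists>s. s \<in> S \<and> s + d \<in> S)" for d
  have "\<not> S \<subseteq> {0}"
    using gcd by (metis Gcd_0_iff zero_neq_one)
  then obtain x where "x \<in> S" "0 < x" by auto
  then have "P x" using zero by (auto simp: P_def intro!: exI[of _ 0])
  define d where "d = (LEAST d. P d)"
  have "P d" unfolding d_def by (rule LeastI) fact
  then obtain s where d: "0 < d" and s: "s \<in> S" "s + d \<in> S" by (auto simp: P_def)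
  have "d dvd x" if x: "x \<in> S" for x
  proof (rule ccontr)
    assume "\<not> d dvd x"
    then have r: "0 < x mod d" by (simp add: dvd_eq_mod_eq_0)
    define q where "q = x div d"
    have "q * (s + d) \<in> S" by (rule mult) (rule s)
    moreover have "q * (s + d) + x mod d = q * s + x"
      by (simp add: q_def distrib_left)
    moreover have "q * s + x \<in> S" by (intro add mult s x)
    ultimately have "P (x mod d)" using r by (auto simp: P_def intro!: exI[of _ "q * (s + d)"])
    then have "d \<le> x mod d" unfolding d_def by (rule Least_le)
    then show False using d by (meson mod_less_divisor not_le)
  qed
  then have "d dvd Gcd S" by (rule Gcd_greatest)
  then have "d = 1" using gcd by simp
  then have s1: "Suc s \<in> S" using s by simp
  have "n \<in> S" if n: "n \<ge> s * s" for n
  proof (cases "s = 0")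
    case True
    then show ?thesis using mult[OF s1, of n] by simp
  next
    case False
    have "n mod s \<le> n div s"
    proof -
      have "s \<le> n div s" using n False by (metis div_le_mono nonzero_mult_div_cancel_right)
      then show ?thesis using False by (meson le_trans less_imp_le mod_less_divisor not_gr_zero)
    qed
    then have "n div s * s = (n div s - n mod s) * s + n mod s * s"
      by (simp flip: distrib_right)
    then have "n = (n div s - n mod s) * s + n mod s * Suc s"
      using div_mult_mod_eq[of n s] by simp
    moreover have "(n div s - n mod s) * s + n mod s * Suc s \<in> S"
      by (intro add mult s s1)
    ultimately show ?thesis by simp
  qed
  then show ?thesis by blast
qed

text \<open>Tannery's theorem. The index runs along an arbitrary filter because the proof of the renewal
  theorem only controls the sequence along a subsequence and its shifts.\<close>

lemma convolution_tendsto: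
  fixes g a :: "nat \<Rightarrow> real"
  assumes g: "summable (\<lambda>j. \<bar>g j\<bar>)" and bound: "\<And>n. \<bar>a n\<bar> \<le> B"
    and r: "filterlim r at_top F" and F: "F \<noteq> bot"
    and lim: "\<And>j. ((\<lambda>k. a (r k - j)) \<longlongrightarrow> l) F"
  shows "((\<lambda>k. \<Sum>j\<le>r k. g j * a (r k - j)) \<longlongrightarrow> l * suminf g) F"
proof -
  define h where "h j k = (if j \<le> r k then g j * a (r k - j) else 0)" for j k
  have "((\<lambda>k. suminf (\<lambda>j. h j k)) \<longlongrightarrow> suminf (\<lambda>j. g j * l)) F"
  proof (rule tannerys_theorem[THEN conjunct2, THEN conjunct2])
    show "((\<lambda>k. h j k) \<longlongrightarrow> g j * l) F" for j
    proof (rule Lim_transform_eventually)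
      show "((\<lambda>k. g j * a (r k - j)) \<longlongrightarrow> g j * l) F" by (intro tendsto_intros lim)
      show "\<forall>\<^sub>F k in F. g j * a (r k - j) = h j k"
        using r[unfolded filterlim_at_top, rule_format, of j] by eventually_elim (simp add: h_def)
    qed
    have "norm (h j k) \<le> \<bar>g j\<bar> * B" for j k
      using bound[of "r k - j"] bound[of 0] by (auto simp: h_def abs_mult intro!: mult_left_mono)
    then show "\<forall>\<^sub>F (j, k) in sequentially \<times>\<^sub>F F. norm (h j k) \<le> \<bar>g j\<bar> * B"
      by (intro always_eventually) auto
    show "summable (\<lambda>j. \<bar>g j\<bar> * B)" by (intro summable_mult2 g)
  qed (rule F)
  moreover have "suminf (\<lambda>j. h j k) = (\<Sum>j\<le>r k. g j * a (r k - j))" for k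
    by (subst suminf_finite[of "{..r k}"]) (auto simp: h_def)
  moreover have "suminf (\<lambda>j. g j * l) = l * suminf g"
    using suminf_mult2[OF summable_rabs_cancel[OF g], of l] by (simp add: mult.commute)
  ultimately show ?thesis by simp
qed

lemma convolution_LIMSEQ:
  fixes g a :: "nat \<Rightarrow> real"
  assumes g: "summable (\<lambda>j. \<bar>g j\<bar>)" and a: "a \<longlonglongrightarrow> l"
  shows "(\<lambda>n. \<Sum>j\<le>n. g j * a (n - j)) \<longlonglongrightarrow> l * suminf g"
proof -
  obtain B where B: "\<And>n. \<bar>a n\<bar> \<le> B"
    using convergent_imp_Bseq[OF convergentI[OF a]] by (auto simp: Bseq_def)
  show ?thesis
  proof (rule convolution_tendsto[OF g B])
    show "(\<lambda>k. a (k - j)) \<longlonglongrightarrow> l" for j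
      using a by (rule filterlim_compose) (simp add: filterlim_minus_const_nat_at_top)
  qed (auto simp: filterlim_ident)
qed

lemma convolution_shift_tendsto_0:
  fixes g a :: "nat \<Rightarrow> real"
  assumes g: "summable (\<lambda>j. \<bar>g j\<bar>)" and a: "a \<longlonglongrightarrow> 0"
  shows "(\<lambda>n. \<Sum>j<n. g j * a (n - Suc j)) \<longlonglongrightarrow> 0"
proof (rule LIMSEQ_imp_Suc)
  show "(\<lambda>n. \<Sum>j<Suc n. g j * a (Suc n - Suc j)) \<longlonglongrightarrow> 0"
    using convolution_LIMSEQ[OF g a] by (simp add: lessThan_Suc_atMost)
qed

lemma fps_nth_shift_convolution:
  fixes x y :: "nat \<Rightarrow> real"
  shows "fps_nth (fps_X * (Abs_fps x * Abs_fps y)) t = (\<Sum>s<t. x s * y (t - Suc s))"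
  unfolding fps_X_mult_nth by (cases t) (simp_all add: fps_mult_nth atLeast0AtMost lessThan_Suc_atMost)

text \<open>\<open>\<rho> n\<close> is the probability that the gap between two renewals exceeds \<open>n\<close>. Describing the gap by its
  tail makes its mean the plain sum of \<open>\<rho>\<close>, so that a finite mean is summability.\<close>

locale renewal =
  fixes \<rho> :: "nat \<Rightarrow> real"
  assumes rho_0: "\<rho> 0 = 1"
    and rho_nonneg: "0 \<le> \<rho> n"
    and rho_mono: "\<rho> (Suc n) \<le> \<rho> n"
    and rho_summable: "summable \<rho>"
    and aperiodic: "Gcd {Suc s |s. \<rho> (Suc s) < \<rho> s} = 1"
begin

text \<open>\<open>\<phi> s\<close> is the probability of a gap of length \<open>Suc s\<close>, and \<open>\<mu>\<close> is the mean gap.\<close>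

definition \<phi> :: "nat \<Rightarrow> real" where "\<phi> s = \<rho> s - \<rho> (Suc s)"

definition \<mu> :: real where "\<mu> = suminf \<rho>"

lemma phi_nonneg: "0 \<le> \<phi> s"
  using rho_mono by (simp add: \<phi>_def)

lemma rho_tendsto_0: "\<rho> \<longlonglongrightarrow> 0"
  by (rule summable_LIMSEQ_zero) (rule rho_summable)

lemma phi_sums: "\<phi> sums 1"
  using telescope_sums'[OF rho_tendsto_0] by (simp add: \<phi>_def[abs_def] rho_0)

lemma sum_phi: "(\<Sum>s<n. \<phi> s) = 1 - \<rho> n"
  using sum_lessThan_telescope'[of \<rho> n] by (simp add: \<phi>_def rho_0)

lemma summable_abs_phi: "summable (\<lambda>s. \<bar>\<phi> s\<bar>)"
  using phi_sums phi_nonneg by (simp add: sums_iff)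

lemma summable_abs_rho: "summable (\<lambda>s. \<bar>\<rho> s\<bar>)"
  using rho_summable rho_nonneg by simp

lemma mu_pos: "0 < \<mu>"
  unfolding \<mu>_def by (rule suminf_pos2[OF rho_summable, of 0]) (auto simp: rho_nonneg rho_0)

text \<open>Summation by parts in the language of generating functions.\<close>

lemma phi_fps: "1 - fps_X * Abs_fps \<phi> = Abs_fps \<rho> * (1 - fps_X)"
proof (rule fps_ext)
  fix n show "fps_nth (1 - fps_X * Abs_fps \<phi>) n = fps_nth (Abs_fps \<rho> * (1 - fps_X)) n"
    by (cases n) (simp_all add: \<phi>_def rho_0 right_diff_distrib)
qed

text \<open>The conserved quantity of the renewal recursion: for the renewal probabilities it says that
  exactly one renewal is the last one up to time \<open>n\<close>.\<close>

lemma convolution_rho_of_renewal: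
  assumes v: "\<And>n. v (Suc n) = (\<Sum>s\<le>n. \<phi> s * v (n - s))"
  shows "(\<Sum>j\<le>n. \<rho> j * v (n - j)) = v 0"
proof -
  have "Abs_fps v = fps_const (v 0) + fps_X * (Abs_fps \<phi> * Abs_fps v)"
  proof (rule fps_ext)
    fix n show "fps_nth (Abs_fps v) n = fps_nth (fps_const (v 0) + fps_X * (Abs_fps \<phi> * Abs_fps v)) n"
      unfolding fps_add_nth fps_nth_shift_convolution by (cases n) (simp_all add: v lessThan_Suc_atMost)
  qed
  then have "Abs_fps v * (1 - fps_X * Abs_fps \<phi>) = fps_const (v 0)"
    by (simp add: algebra_simps)
  then have "(Abs_fps \<rho> * Abs_fps v) * (1 - fps_X) = fps_const (v 0)"
    by (simp add: phi_fps algebra_simps)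
  then have *: "fps_nth (Abs_fps \<rho> * Abs_fps v * (1 - fps_X)) n = fps_nth (fps_const (v 0)) n" for n
    by simp
  have "fps_nth (Abs_fps \<rho> * Abs_fps v) n = v 0"
  proof (induction n)
    case 0 then show ?case using *[of 0] by (simp add: rho_0)
  next
    case (Suc n) then show ?case using *[of "Suc n"] by (simp add: algebra_simps)
  qed
  then show ?thesis by (simp add: fps_mult_nth atLeast0AtMost)
qed

text \<open>If \<open>l\<close> is the largest limit point and \<open>v\<close> approaches it along \<open>r\<close>, then an average of earlier
  values approaches its own upper bound, which forces each term of positive weight to do so.\<close>

lemma renewal_tendsto_shift:
  assumes v: "\<And>n. v (Suc n) = (\<Sum>s\<le>n. \<phi> s * v (n - s))"
    and bound: "\<And>n. \<bar>v n\<bar> \<le> B"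
    and upper: "\<And>\<epsilon>. \<epsilon> > 0 \<Longrightarrow> \<forall>\<^sub>F n in sequentially. v n < l + \<epsilon>"
    and r: "filterlim r at_top sequentially" and lim: "(\<lambda>k. v (r k)) \<longlonglongrightarrow> l"
    and pos: "\<phi> i > 0"
  shows "(\<lambda>k. v (r k - Suc i)) \<longlonglongrightarrow> l"
proof -
  \<comment> \<open>The excess \<open>w\<close> of \<open>v\<close> over \<open>l\<close> vanishes in the limit; the deficit \<open>y\<close> is nonnegative and small along \<open>r\<close>.\<close>
  define w where "w n = max 0 (v n - l)" for n
  define y where "y n = l - v n + w n" for n
  have y_nonneg: "y n \<ge> 0" for n by (simp add: y_def w_def)
  have w: "w \<longlonglongrightarrow> 0"
  proof (rule tendstoI)
    fix \<epsilon> :: real assume "\<epsilon> > 0"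
    then show "\<forall>\<^sub>F n in sequentially. dist (w n) 0 < \<epsilon>"
      using upper[of \<epsilon>] by (auto simp: w_def dist_real_def elim!: eventually_mono)
  qed
  have rm: "filterlim (\<lambda>k. r k - j) at_top sequentially" for j
    using filterlim_compose[OF filterlim_minus_const_nat_at_top r, of j] by simp
  have conv: "(\<Sum>s\<le>n. \<phi> s * y (n - s)) = l * (1 - \<rho> (Suc n)) - v (Suc n) + (\<Sum>s\<le>n. \<phi> s * w (n - s))" for n
  proof -
    have "(\<Sum>s\<le>n. \<phi> s * y (n - s)) = (\<Sum>s\<le>n. l * \<phi> s - \<phi> s * v (n - s) + \<phi> s * w (n - s))"
      by (intro sum.cong refl) (simp add: y_def algebra_simps)
    also have "\<dots> = l * (\<Sum>s\<le>n. \<phi> s) - v (Suc n) + (\<Sum>s\<le>n. \<phi> s * w (n - s))"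
      by (simp add: v sum.distrib sum_subtractf sum_distrib_left)
    also have "(\<Sum>s\<le>n. \<phi> s) = 1 - \<rho> (Suc n)"
      using sum_phi[of "Suc n"] by (simp only: lessThan_Suc_atMost)
    finally show ?thesis .
  qed
  have "(\<lambda>k. l * (1 - \<rho> (r k)) - v (r k) + (\<Sum>s\<le>r k - 1. \<phi> s * w (r k - 1 - s)))
      \<longlonglongrightarrow> l * (1 - 0) - l + 0 * suminf \<phi>"
    by (intro tendsto_add tendsto_diff tendsto_mult tendsto_const lim
          filterlim_compose[OF rho_tendsto_0 r] filterlim_compose[OF convolution_LIMSEQ[OF summable_abs_phi w] rm[of 1]])
  moreover have "\<forall>\<^sub>F k in sequentially. l * (1 - \<rho> (r k)) - v (r k) + (\<Sum>s\<le>r k - 1. \<phi> s * w (r k - 1 - s))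
      = (\<Sum>s\<le>r k - 1. \<phi> s * y (r k - 1 - s))"
    using r[unfolded filterlim_at_top, rule_format, of 1]
  proof eventually_elim
    case (elim k)
    then show ?case using conv[of "r k - 1"] by simp
  qed
  ultimately have "(\<lambda>k. \<Sum>s\<le>r k - 1. \<phi> s * y (r k - 1 - s)) \<longlonglongrightarrow> 0"
    by (simp add: tendsto_cong)
  moreover have "\<forall>\<^sub>F k in sequentially. norm (\<phi> i * y (r k - Suc i)) \<le> (\<Sum>s\<le>r k - 1. \<phi> s * y (r k - 1 - s))"
    using r[unfolded filterlim_at_top, rule_format, of "Suc i"]
  proof eventually_elim
    case (elim k)
    have "\<phi> i * y (r k - 1 - i) \<le> (\<Sum>s\<le>r k - 1. \<phi> s * y (r k - 1 - s))"
      using elim by (intro member_le_sum) (auto simp: phi_nonneg y_nonneg)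
    then show ?case by (simp add: phi_nonneg y_nonneg)
  qed
  ultimately have "(\<lambda>k. \<phi> i * y (r k - Suc i)) \<longlonglongrightarrow> 0"
    by (rule Lim_null_comparison[rotated])
  then have "(\<lambda>k. y (r k - Suc i)) \<longlonglongrightarrow> 0"
    using pos by (simp add: tendsto_mult_left_iff[of "\<phi> i" _ 0, simplified])
  moreover have "(\<lambda>k. w (r k - Suc i)) \<longlonglongrightarrow> 0"
    by (rule filterlim_compose[OF w rm])
  ultimately have "(\<lambda>k. l - y (r k - Suc i) + w (r k - Suc i)) \<longlonglongrightarrow> l - 0 + 0"
    by (intro tendsto_intros)
  then show ?thesis by (simp add: y_def)
qed

text \<open>Let \<open>l\<close> be the limit superior. The shifts that preserve convergence to \<open>l\<close> along subsequences form
  an additive set containing all possible gaps, so by aperiodicity all large shifts do. Then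
  the conserved quantity, evaluated along a shifted subsequence, identifies \<open>l\<close>.\<close>

lemma renewal_upper:
  assumes v: "\<And>n. v (Suc n) = (\<Sum>s\<le>n. \<phi> s * v (n - s))"
    and bound: "\<And>n. \<bar>v n\<bar> \<le> B" and "\<epsilon> > 0"
  shows "\<forall>\<^sub>F n in sequentially. v n < v 0 / \<mu> + \<epsilon>"
proof -
  obtain r where r: "strict_mono r" and lim: "((\<lambda>n. ereal (v n)) \<circ> r) \<longlonglongrightarrow> limsup (\<lambda>n. ereal (v n))"
    using limsup_subseq_lim by blast
  have "limsup (\<lambda>n. ereal (v n)) \<le> ereal B"
    using bound by (intro Limsup_bounded always_eventually) (auto simp: abs_le_iff)
  moreover have "ereal (- B) \<le> limsup (\<lambda>n. ereal (v n))"
  proof (rule LIMSEQ_le_const[OF lim])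
    show "\<exists>N. \<forall>n\<ge>N. ereal (- B) \<le> ((\<lambda>n. ereal (v n)) \<circ> r) n"
      using bound by (auto simp: abs_le_iff minus_le_iff)
  qed
  ultimately obtain l where l: "limsup (\<lambda>n. ereal (v n)) = ereal l"
    by (cases "limsup (\<lambda>n. ereal (v n))") auto
  have upper: "\<forall>\<^sub>F n in sequentially. v n < l + \<epsilon>" if "\<epsilon> > 0" for \<epsilon>
    using Limsup_lessD[of sequentially "\<lambda>n. ereal (v n)" "ereal (l + \<epsilon>)"] l that by simp
  define good where "good r \<longleftrightarrow> filterlim r at_top sequentially \<and> (\<lambda>k. v (r k)) \<longlonglongrightarrow> l" for r
  have "good r"
    using lim filterlim_subseq[OF r] by (simp add: good_def l o_def)
  define H where "H = {h. \<forall>r. good r \<longrightarrow> good (\<lambda>k. r k - h)}"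
  have supp: "{Suc s |s. \<rho> (Suc s) < \<rho> s} \<subseteq> H"
  proof safe
    fix s assume s: "\<rho> (Suc s) < \<rho> s"
    have "good (\<lambda>k. r k - Suc s)" if "good r" for r
      using renewal_tendsto_shift[OF v bound upper, of r s] that s
        filterlim_compose[OF filterlim_minus_const_nat_at_top, of r sequentially "Suc s"]
      by (auto simp: good_def \<phi>_def)
    then show "Suc s \<in> H" by (auto simp: H_def)
  qed
  have "Gcd H dvd Gcd {Suc s |s. \<rho> (Suc s) < \<rho> s}"
    using supp by (intro Gcd_greatest) (auto intro: Gcd_dvd)
  then have "Gcd H = 1" by (simp add: aperiodic)
  moreover have "x + y \<in> H" if "x \<in> H" "y \<in> H" for x y
    using that by (auto simp: H_def simp flip: diff_diff_left)
  moreover have "0 \<in> H" by (simp add: H_def)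
  ultimately obtain h0 where h0: "\<And>h. h \<ge> h0 \<Longrightarrow> h \<in> H"
    using Gcd_1_closed_contains_all_large[of H] by blast
  define q where "q k = r k - h0" for k
  have "good q" using h0[of h0] \<open>good r\<close> by (simp add: H_def q_def[abs_def])
  then have q: "filterlim q at_top sequentially" by (simp add: good_def)
  have lim': "(\<lambda>k. v (q k - j)) \<longlonglongrightarrow> l" for j
    using h0[of "h0 + j"] \<open>good r\<close> by (auto simp: H_def q_def good_def simp flip: diff_diff_left)
  have "(\<lambda>k. \<Sum>j\<le>q k. \<rho> j * v (q k - j)) \<longlonglongrightarrow> l * \<mu>"
    unfolding \<mu>_def by (rule convolution_tendsto[OF summable_abs_rho bound q _ lim']) simp
  then have "v 0 = l * \<mu>"
    by (simp add: convolution_rho_of_renewal[OF v] LIMSEQ_const_iff)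
  then have "l = v 0 / \<mu>" using mu_pos by simp
  then show ?thesis using upper[OF \<open>\<epsilon> > 0\<close>] by simp
qed

text \<open>The renewal probabilities: \<open>u n\<close> is the probability of a renewal at time \<open>n\<close>.\<close>

fun u :: "nat \<Rightarrow> real" where
  "u 0 = 1"
| "u (Suc n) = (\<Sum>s\<le>n. \<phi> s * u (n - s))"

lemma u_bounds: "0 \<le> u n \<and> u n \<le> 1"
proof (induction n rule: less_induct)
  case (less n)
  show ?case
  proof (cases n)
    case (Suc m)
    have "(\<Sum>s\<le>m. \<phi> s * u (m - s)) \<le> (\<Sum>s\<le>m. \<phi> s * 1)"
      using less Suc by (intro sum_mono mult_left_mono phi_nonneg) auto
    also have "\<dots> \<le> 1" using sum_phi[of "Suc m"] rho_nonneg[of "Suc m"] by (simp add: lessThan_Suc_atMost)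
    finally show ?thesis using less Suc by (auto intro!: sum_nonneg mult_nonneg_nonneg phi_nonneg)
  qed simp
qed

text \<open>The upper bound applies to \<open>u\<close> and to \<open>-u\<close>, since the recursion is linear.\<close>

theorem renewal_theorem: "u \<longlonglongrightarrow> 1 / \<mu>"
proof (rule tendstoI)
  fix \<epsilon> :: real assume \<epsilon>: "\<epsilon> > 0"
  have "\<forall>\<^sub>F n in sequentially. u n < u 0 / \<mu> + \<epsilon>"
    using u_bounds by (intro renewal_upper[where B = 1] \<epsilon>) auto
  moreover have "\<forall>\<^sub>F n in sequentially. - u n < - u 0 / \<mu> + \<epsilon>"
    using u_bounds by (intro renewal_upper[where B = 1] \<epsilon>) (auto simp: sum_negf)
  ultimately show "\<forall>\<^sub>F n in sequentially. dist (u n) (1 / \<mu>) < \<epsilon>"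
    by eventually_elim (auto simp: dist_real_def)
qed

text \<open>In terms of generating functions the equation divides by \<open>1 - X \<phi>\<close>, whose inverse is the series
  of the renewal probabilities.\<close>

lemma renewal_solution:
  assumes x: "\<And>t. x t = e t + (\<Sum>s<t. \<phi> s * x (t - Suc s))"
  shows "x t = (\<Sum>j\<le>t. e j * u (t - j))"
proof -
  have "Abs_fps x = Abs_fps e + fps_X * (Abs_fps \<phi> * Abs_fps x)"
    by (rule fps_ext) (simp only: fps_add_nth fps_nth_shift_convolution fps_nth_Abs_fps, rule x)
  then have "Abs_fps x * (1 - fps_X * Abs_fps \<phi>) = Abs_fps e"
    by (simp add: algebra_simps)
  moreover have "Abs_fps u = 1 + fps_X * (Abs_fps \<phi> * Abs_fps u)"
  proof (rule fps_ext)
    fix n show "fps_nth (Abs_fps u) n = fps_nth (1 + fps_X * (Abs_fps \<phi> * Abs_fps u)) n"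
      unfolding fps_add_nth fps_nth_shift_convolution by (cases n) (simp_all add: lessThan_Suc_atMost)
  qed
  then have "(1 - fps_X * Abs_fps \<phi>) * Abs_fps u = 1"
    by (simp add: algebra_simps)
  ultimately have "Abs_fps x = Abs_fps e * Abs_fps u"
    by (metis mult.assoc mult.right_neutral)
  then have "fps_nth (Abs_fps x) t = fps_nth (Abs_fps e * Abs_fps u) t" by simp
  then show ?thesis by (simp add: fps_mult_nth atLeast0AtMost)
qed

text \<open>The rate \<open>\<theta>\<close> depends on the inhomogeneity only through the dominating sequence \<open>g\<close>; this is what
  later gives convergence uniformly over families of events.\<close>

theorem renewal_equation_uniform_limit:
  assumes g: "summable g"
  obtains \<theta> where "\<theta> \<longlonglongrightarrow> 0"
    and "\<And>x e. (\<And>t. x t = e t + (\<Sum>s<t. \<phi> s * x (t - Suc s))) \<Longrightarrow> (\<And>t. \<bar>e t\<bar> \<le> g t) \<Longrightarrow>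
      (\<exists>L. \<forall>t. \<bar>x t - L\<bar> \<le> \<theta> t)"
proof (cases "\<forall>t. 0 \<le> g t")
  case False
  have "\<not> (\<forall>t. \<bar>e t\<bar> \<le> g t)" for e :: "nat \<Rightarrow> real"
    using False by (meson abs_ge_zero order_trans)
  then show ?thesis using that[of "\<lambda>_. 0"] by blast
next
  case True
  then have g_abs: "summable (\<lambda>j. \<bar>g j\<bar>)" using g by simp
  \<comment> \<open>The limit of \<open>x\<close> is \<open>suminf e / \<mu>\<close>; the two terms bound the effect of replacing \<open>u\<close> by its limit and of the missing tail.\<close>
  define \<theta> where "\<theta> t = (\<Sum>j\<le>t. g j * \<bar>u (t - j) - 1 / \<mu>\<bar>) + suminf (\<lambda>j. g (j + Suc t)) / \<mu>" for t
  show thesis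
  proof (rule that[of \<theta>])
    have "(\<lambda>t. \<bar>u t - 1 / \<mu>\<bar>) \<longlonglongrightarrow> \<bar>1 / \<mu> - 1 / \<mu>\<bar>"
      by (intro tendsto_intros renewal_theorem)
    then have "(\<lambda>t. \<Sum>j\<le>t. g j * \<bar>u (t - j) - 1 / \<mu>\<bar>) \<longlonglongrightarrow> 0 * suminf g"
      by (intro convolution_LIMSEQ[OF g_abs, of "\<lambda>t. \<bar>u t - 1 / \<mu>\<bar>"]) simp
    moreover have "(\<lambda>t. suminf (\<lambda>j. g (j + Suc t))) \<longlonglongrightarrow> 0"
      by (rule filterlim_compose[OF suminf_exist_split2[OF g] filterlim_Suc])
    then have "(\<lambda>t. suminf (\<lambda>j. g (j + Suc t)) / \<mu>) \<longlonglongrightarrow> 0 / \<mu>"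
      using mu_pos by (intro tendsto_intros) auto
    ultimately have "(\<lambda>t. (\<Sum>j\<le>t. g j * \<bar>u (t - j) - 1 / \<mu>\<bar>) + suminf (\<lambda>j. g (j + Suc t)) / \<mu>)
        \<longlonglongrightarrow> 0 * suminf g + 0 / \<mu>"
      by (rule tendsto_add)
    then show "\<theta> \<longlonglongrightarrow> 0" by (simp add: \<theta>_def[abs_def])
  next
    fix x e :: "nat \<Rightarrow> real"
    assume x: "\<And>t. x t = e t + (\<Sum>s<t. \<phi> s * x (t - Suc s))" and e: "\<And>t. \<bar>e t\<bar> \<le> g t"
    have e_abs: "summable (\<lambda>j. \<bar>e j\<bar>)"
      by (rule summable_comparison_test'[OF g]) (simp add: e)
    then have e_sum: "summable e" by (rule summable_rabs_cancel)
    have "\<bar>x t - suminf e / \<mu>\<bar> \<le> \<theta> t" for t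
    proof -
      have shift: "summable (\<lambda>j. e (j + Suc t))" "summable (\<lambda>j. \<bar>e (j + Suc t)\<bar>)" "summable (\<lambda>j. g (j + Suc t))"
        using e_sum e_abs g by (simp_all only: summable_iff_shift summable_iff_shift[of "\<lambda>j. \<bar>e j\<bar>"])
      have "x t - suminf e / \<mu> = (\<Sum>j\<le>t. e j * (u (t - j) - 1 / \<mu>)) - suminf (\<lambda>j. e (j + Suc t)) / \<mu>"
        using suminf_split_initial_segment[OF e_sum, of "Suc t"]
        by (simp add: renewal_solution[OF x] lessThan_Suc_atMost right_diff_distrib sum_subtractf
            add_divide_distrib sum_divide_distrib)
      moreover have "\<bar>\<Sum>j\<le>t. e j * (u (t - j) - 1 / \<mu>)\<bar> \<le> (\<Sum>j\<le>t. g j * \<bar>u (t - j) - 1 / \<mu>\<bar>)"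
        by (rule order_trans[OF sum_abs]) (auto simp: abs_mult intro!: sum_mono mult_right_mono e)
      moreover have "\<bar>suminf (\<lambda>j. e (j + Suc t)) / \<mu>\<bar> \<le> suminf (\<lambda>j. g (j + Suc t)) / \<mu>"
      proof -
        have "\<bar>suminf (\<lambda>j. e (j + Suc t))\<bar> \<le> suminf (\<lambda>j. \<bar>e (j + Suc t)\<bar>)"
          by (rule summable_rabs) (rule shift)
        also have "\<dots> \<le> suminf (\<lambda>j. g (j + Suc t))"
          by (rule suminf_le) (simp_all only: e shift)
        finally show ?thesis using mu_pos by (simp add: divide_right_mono)
      qed
      ultimately show ?thesis unfolding \<theta>_def by linarith
    qed
    then show "\<exists>L. \<forall>t. \<bar>x t - L\<bar> \<le> \<theta> t" by blast
  qed
qed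

end

section \<open>Finite stretches of the driving chain\<close>

text \<open>The law of \<open>Z\<^sub>1, \<dots>, Z\<^sub>t\<close> for the chain started at \<open>z\<close>. Paths are discrete, so this law is a
  probability mass function and every set of paths is an event.\<close>

primrec chain_path :: "('z \<Rightarrow> 'z pmf) \<Rightarrow> nat \<Rightarrow> 'z \<Rightarrow> 'z list pmf" where
  "chain_path K 0 z = return_pmf []"
| "chain_path K (Suc t) z = bind_pmf (chain_path K t z) (\<lambda>p. map_pmf (\<lambda>z'. p @ [z']) (K (last (z # p))))"

text \<open>The position after feeding \<open>z\<close> and then all but the last entry of the list to the recursion: the
  last entry is the state of the chain that drives the next step.\<close>

primrec drive :: "(real \<Rightarrow> 'z \<Rightarrow> real) \<Rightarrow> real \<Rightarrow> 'z \<Rightarrow> 'z list \<Rightarrow> real" where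
  "drive f x z [] = x"
| "drive f x z (z' # p) = drive f (f x z) z' p"

lemma last_Cons_append: "last (z # p @ q) = last (last (z # p) # q)"
  by (cases q rule: rev_cases) auto

lemma path_add:
  "chain_path K (m + n) z = bind_pmf (chain_path K m z) (\<lambda>p. map_pmf ((@) p) (chain_path K n (last (z # p))))"
proof (induction n)
  case 0
  then show ?case by (simp add: bind_return_pmf')
next
  case (Suc n)
  then show ?case
    by (simp add: bind_assoc_pmf map_bind_pmf bind_map_pmf pmf.map_comp o_def last_Cons_append
             del: last.simps)
qed

lemma length_path: "p \<in> set_pmf (chain_path K t z) \<Longrightarrow> length p = t"
  by (induction t arbitrary: p) auto

lemma drive_append: "drive f x z (p @ q) = drive f (drive f x z p) (last (z # p)) q"
  by (induction p arbitrary: x z) auto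

lemma pmf_path_snoc:
  "pmf (chain_path K (Suc t) z) (p @ [z']) = pmf (chain_path K t z) p * pmf (K (last (z # p))) z'"
proof -
  have eq: "pmf (map_pmf (\<lambda>y. p' @ [y]) (K (last (z # p')))) (p @ [z']) =
      indicator {p} p' * pmf (K (last (z # p))) z'" for p'
  proof (cases "p' = p")
    case True
    then show ?thesis
      by (simp add: pmf_map_inj'[of "\<lambda>y. p @ [y]"] inj_on_def del: last.simps)
  next
    case False
    then show ?thesis by (simp add: pmf_map_outside image_def)
  qed
  have "pmf (chain_path K (Suc t) z) (p @ [z']) =
      (\<integral>p'. indicator {p} p' * pmf (K (last (z # p))) z' \<partial>measure_pmf (chain_path K t z))"
    by (simp add: pmf_bind eq del: last.simps)
  also have "\<dots> = pmf (chain_path K t z) p * pmf (K (last (z # p))) z'"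
    by (simp add: measure_pmf_single)
  finally show ?thesis .
qed

lemma measure_bind_pmf:
  "measure_pmf.prob (bind_pmf p g) A = (\<integral>x. measure_pmf.prob (g x) A \<partial>measure_pmf p)"
proof -
  have int: "integrable (measure_pmf p) (\<lambda>x. measure_pmf.prob (g x) A)"
    by (rule measure_pmf.integrable_const_bound[where B = 1]) auto
  have "emeasure (bind_pmf p g) A = (\<integral>\<^sup>+x. ennreal (measure_pmf.prob (g x) A) \<partial>measure_pmf p)"
    unfolding emeasure_bind_pmf by (simp only: measure_pmf.emeasure_eq_measure)
  also have "\<dots> = ennreal (\<integral>x. measure_pmf.prob (g x) A \<partial>measure_pmf p)"
    by (rule nn_integral_eq_integral[OF int]) simp
  finally show ?thesis
    by (simp add: measure_def)
qed

lemma measure_path_add: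
  "measure_pmf.prob (chain_path K (m + n) z) E =
    (\<integral>p. measure_pmf.prob (chain_path K n (last (z # p))) {q. p @ q \<in> E} \<partial>chain_path K m z)"
  unfolding path_add measure_bind_pmf by (simp add: vimage_def del: last.simps)

lemma map_take_path: "map_pmf (take m) (chain_path K (m + n) z) = chain_path K m z"
proof -
  have "map_pmf (take m) (chain_path K (m + n) z) =
      bind_pmf (chain_path K m z) (\<lambda>p. map_pmf (\<lambda>q. take m (p @ q)) (chain_path K n (last (z # p))))"
    unfolding path_add by (simp add: map_bind_pmf pmf.map_comp o_def del: last.simps)
  also have "\<dots> = bind_pmf (chain_path K m z) return_pmf"
    by (intro bind_pmf_cong refl) (auto dest: length_path)
  finally show ?thesis by (simp add: bind_return_pmf')
qed

lemma nn_integral_pmf_swap: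
  fixes h :: "'a \<Rightarrow> 'b \<Rightarrow> ennreal"
  shows "(\<integral>\<^sup>+x. \<integral>\<^sup>+y. h x y \<partial>measure_pmf q \<partial>measure_pmf p) = (\<integral>\<^sup>+y. \<integral>\<^sup>+x. h x y \<partial>measure_pmf p \<partial>measure_pmf q)"
proof -
  have "(\<integral>\<^sup>+x. \<integral>\<^sup>+y. h x y \<partial>measure_pmf q \<partial>measure_pmf p) =
      (\<integral>\<^sup>+w. case_prod h w \<partial>measure_pmf (bind_pmf p (\<lambda>x. bind_pmf q (\<lambda>y. return_pmf (x, y)))))"
    by simp
  also have "bind_pmf p (\<lambda>x. bind_pmf q (\<lambda>y. return_pmf (x, y))) =
      bind_pmf q (\<lambda>y. bind_pmf p (\<lambda>x. return_pmf (x, y)))"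
    by (rule bind_commute_pmf)
  finally show ?thesis by simp
qed

lemma nn_integral_count_space_swap:
  fixes h :: "'a \<Rightarrow> 'b \<Rightarrow> ennreal"
  shows "(\<integral>\<^sup>+x. \<integral>\<^sup>+y. h x y \<partial>count_space UNIV \<partial>count_space UNIV) =
    (\<integral>\<^sup>+y. \<integral>\<^sup>+x. h x y \<partial>count_space UNIV \<partial>count_space UNIV)"
  using nn_integral_fst_count_space[of "case_prod h"] nn_integral_snd_count_space[of "case_prod h"]
  by simp

lemma nn_integral_pmf_count_space_swap:
  fixes h :: "'a \<Rightarrow> 'b \<Rightarrow> ennreal"
  shows "(\<integral>\<^sup>+x. \<integral>\<^sup>+y. h x y \<partial>count_space UNIV \<partial>measure_pmf p) =
    (\<integral>\<^sup>+y. \<integral>\<^sup>+x. h x y \<partial>measure_pmf p \<partial>count_space UNIV)"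
  by (subst (1 2) nn_integral_measure_pmf)
    (simp add: nn_integral_count_space_swap[of "\<lambda>x y. _ x * h x y"] flip: nn_integral_cmult)

lemma nn_integral_indicator_fibre:
  "(\<integral>\<^sup>+z. \<integral>\<^sup>+p. indicator {z} (g p) * k \<partial>measure_pmf P \<partial>count_space UNIV) = (k :: ennreal)"
proof -
  have "(\<integral>\<^sup>+z. \<integral>\<^sup>+p. indicator {z} (g p) * k \<partial>measure_pmf P \<partial>count_space UNIV) =
      (\<integral>\<^sup>+p. \<integral>\<^sup>+z. indicator {z} (g p) * k \<partial>count_space UNIV \<partial>measure_pmf P)"
    by (rule nn_integral_pmf_count_space_swap[symmetric])
  also have "\<dots> = (\<integral>\<^sup>+p. \<integral>\<^sup>+z. k * indicator {g p} z \<partial>count_space UNIV \<partial>measure_pmf P)"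
    by (intro nn_integral_cong) (auto simp: indicator_def)
  also have "\<dots> = k" by (simp add: nn_integral_indicator_singleton measure_pmf.emeasure_space_1)
  finally show ?thesis .
qed

text \<open>Conditionally on the state at the cut, the piece after it can be drawn first. The
  event at the end can then be pulled back along the second piece before the first
  piece is looked at.\<close>

lemma nn_integral_path_cut:
  fixes h :: "'z list \<Rightarrow> 'z list \<Rightarrow> ennreal"
  shows "(\<integral>\<^sup>+r. h (take t r) (drop t r) \<partial>chain_path K (t + n) z) =
    (\<integral>\<^sup>+z'. \<integral>\<^sup>+q. \<integral>\<^sup>+p. h p q * indicator {z'} (last (z # p)) \<partial>chain_path K t z \<partial>chain_path K n z' \<partial>count_space UNIV)"
proof -
  have "(\<integral>\<^sup>+r. h (take t r) (drop t r) \<partial>chain_path K (t + n) z) =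
      (\<integral>\<^sup>+p. \<integral>\<^sup>+q. h p q \<partial>chain_path K n (last (z # p)) \<partial>chain_path K t z)"
    unfolding path_add by (auto intro!: nn_integral_cong_AE AE_pmfI dest: length_path)
  also have "\<dots> = (\<integral>\<^sup>+p. \<integral>\<^sup>+z'. (\<integral>\<^sup>+q. h p q \<partial>chain_path K n z') * indicator {last (z # p)} z' \<partial>count_space UNIV \<partial>chain_path K t z)"
    by (intro nn_integral_cong) (simp add: nn_integral_count_space_indicator nn_integral_indicator_singleton)
  also have "\<dots> = (\<integral>\<^sup>+z'. \<integral>\<^sup>+p. (\<integral>\<^sup>+q. h p q \<partial>chain_path K n z') * indicator {last (z # p)} z' \<partial>chain_path K t z \<partial>count_space UNIV)"
    by (rule nn_integral_pmf_count_space_swap)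
  also have "\<dots> = (\<integral>\<^sup>+z'. \<integral>\<^sup>+p. \<integral>\<^sup>+q. h p q * indicator {z'} (last (z # p)) \<partial>chain_path K n z' \<partial>chain_path K t z \<partial>count_space UNIV)"
    by (intro nn_integral_cong) (auto simp: nn_integral_multc indicator_def)
  finally show ?thesis by (subst nn_integral_pmf_swap)
qed

declare chain_path.simps(2) [simp del]

section \<open>Decomposition at the atom\<close>

text \<open>The tail probability that the first visit to \<open>z0\<close> at a positive time comes after \<open>t\<close>.\<close>

definition avoid :: "('z \<Rightarrow> 'z pmf) \<Rightarrow> 'z \<Rightarrow> nat \<Rightarrow> 'z \<Rightarrow> real" where
  "avoid K z0 t z = measure_pmf.prob (chain_path K t z) {p. z0 \<notin> set p}"

lemma avoid_0 [simp]: "avoid K z0 0 z = 1"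
  by (simp add: avoid_def)

lemma avoid_nonneg: "0 \<le> avoid K z0 t z"
  by (simp add: avoid_def)

definition first_visit :: "'z \<Rightarrow> 'z list \<Rightarrow> bool" where
  "first_visit z0 p \<longleftrightarrow> p \<noteq> [] \<and> last p = z0 \<and> z0 \<notin> set (butlast p)"

lemma prob_first_visit_cut:
  "measure_pmf.prob (chain_path K (Suc s + n) z) {r. r \<in> E \<and> z0 \<notin> set (take s r)} -
   measure_pmf.prob (chain_path K (Suc s + n) z) {r. r \<in> E \<and> z0 \<notin> set (take (Suc s) r)} =
   (\<integral>p. indicator {p. first_visit z0 p} p * measure_pmf.prob (chain_path K n z0) {q. p @ q \<in> E}
      \<partial>chain_path K (Suc s) z)" (is "?B1 - ?B2 = ?R")
proof -
  have "?B1 - ?B2 = measure_pmf.prob (chain_path K (Suc s + n) z)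
      ({r. r \<in> E \<and> z0 \<notin> set (take s r)} - {r. r \<in> E \<and> z0 \<notin> set (take (Suc s) r)})"
    by (intro measure_pmf.finite_measure_Diff[symmetric]) (auto dest: set_take_subset_set_take[of s "Suc s", simplified, THEN subsetD])
  also have "{r. r \<in> E \<and> z0 \<notin> set (take s r)} - {r. r \<in> E \<and> z0 \<notin> set (take (Suc s) r)} =
      {r. r \<in> E \<and> z0 \<notin> set (take s r) \<and> z0 \<in> set (take (Suc s) r)}" (is "_ = ?E")
    by auto
  also have "measure_pmf.prob (chain_path K (Suc s + n) z) ?E = ?R"
    unfolding measure_path_add
  proof (intro integral_cong_AE AE_pmfI)
    fix p assume "p \<in> set_pmf (chain_path K (Suc s) z)"
    then have len: "length p = Suc s" by (rule length_path)
    then obtain p' y where p: "p = p' @ [y]" "length p' = s"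
      by (metis append_butlast_last_id diff_Suc_1 length_butlast length_greater_0_conv zero_less_Suc)
    show "measure_pmf.prob (chain_path K n (last (z # p))) {q. p @ q \<in> ?E} =
        indicator {p. first_visit z0 p} p * measure_pmf.prob (chain_path K n z0) {q. p @ q \<in> E}"
      by (auto simp: p first_visit_def indicator_def)
  qed auto
  finally show ?thesis .
qed

lemma prob_first_visit:
  "measure_pmf.prob (chain_path K (Suc s) z) {p. first_visit z0 p} = avoid K z0 s z - avoid K z0 (Suc s) z"
proof -
  have 1: "measure_pmf.prob (chain_path K (Suc s) z) {r. z0 \<notin> set (take s r)} = avoid K z0 s z"
    unfolding avoid_def map_take_path[of s K 1 z, symmetric] by (simp add: vimage_def)
  have 2: "measure_pmf.prob (chain_path K (Suc s) z) {r. z0 \<notin> set (take (Suc s) r)} = avoid K z0 (Suc s) z"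
    unfolding avoid_def
    by (intro measure_pmf.finite_measure_eq_AE AE_pmfI) (auto dest!: length_path)
  show ?thesis
    using prob_first_visit_cut[of K s 0 z UNIV z0] by (simp add: 1 2)
qed

lemma avoid_Suc_le: "avoid K z0 (Suc s) z \<le> avoid K z0 s z"
  using prob_first_visit[of K s z z0] measure_nonneg[of "chain_path K (Suc s) z" "{p. first_visit z0 p}"] by linarith

text \<open>The probabilities of \<open>E\<close> without a visit up to time \<open>s\<close> telescope in \<open>s\<close>, and each increment is the
  contribution of the paths whose first visit happens at that time.\<close>

lemma first_visit_decomposition:
  "measure_pmf.prob (chain_path K t z) E =
    measure_pmf.prob (chain_path K t z) {r \<in> E. z0 \<notin> set r} +
    (\<Sum>s<t. \<integral>p. indicator {p. first_visit z0 p} p * measure_pmf.prob (chain_path K (t - Suc s) z0) {q. p @ q \<in> E}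
      \<partial>chain_path K (Suc s) z)"
proof -
  define B where "B s = measure_pmf.prob (chain_path K t z) {r. r \<in> E \<and> z0 \<notin> set (take s r)}" for s
  have "(\<Sum>s<t. \<integral>p. indicator {p. first_visit z0 p} p * measure_pmf.prob (chain_path K (t - Suc s) z0) {q. p @ q \<in> E}
      \<partial>chain_path K (Suc s) z) = (\<Sum>s<t. B s - B (Suc s))"
  proof (intro sum.cong refl)
    fix s assume "s \<in> {..<t}"
    then have "Suc s + (t - Suc s) = t" by simp
    then show "(\<integral>p. indicator {p. first_visit z0 p} p * measure_pmf.prob (chain_path K (t - Suc s) z0) {q. p @ q \<in> E}
      \<partial>chain_path K (Suc s) z) = B s - B (Suc s)"
      using prob_first_visit_cut[of K s "t - Suc s" z E z0] by (simp only: B_def)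
  qed
  also have "\<dots> = B 0 - B t" by (rule sum_lessThan_telescope')
  also have "B 0 = measure_pmf.prob (chain_path K t z) E" by (simp add: B_def)
  also have "B t = measure_pmf.prob (chain_path K t z) {r \<in> E. z0 \<notin> set r}"
    unfolding B_def by (intro measure_pmf.finite_measure_eq_AE AE_pmfI) (auto dest!: length_path)
  finally show ?thesis by simp
qed

section \<open>Monotone recursions driven by a chain\<close>

locale monotone_recursion =
  fixes K :: "'z::countable \<Rightarrow> 'z pmf" and f :: "real \<Rightarrow> 'z \<Rightarrow> real" and a b :: real and z0 :: 'z
  assumes a_le_b: "a \<le> b"
    and f_in: "x \<in> {a..b} \<Longrightarrow> f x z \<in> {a..b}"
    and f_mono: "x \<in> {a..b} \<Longrightarrow> y \<in> {a..b} \<Longrightarrow> x \<le> y \<Longrightarrow> f x z \<le> f y z"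
begin

lemma drive_in: "x \<in> {a..b} \<Longrightarrow> drive f x z p \<in> {a..b}"
  by (induction p arbitrary: x z) (simp_all add: f_in del: atLeastAtMost_iff)

lemma drive_mono: "x \<in> {a..b} \<Longrightarrow> y \<in> {a..b} \<Longrightarrow> x \<le> y \<Longrightarrow> drive f x z p \<le> drive f y z p"
  by (induction p arbitrary: x y z) (simp_all add: f_in f_mono del: atLeastAtMost_iff)

text \<open>Half-lines \<open>{..y}\<close> are not stable under preimages by monotone maps with jumps, which may
  turn them into open half-lines; lower sets are.\<close>

definition lower :: "real set \<Rightarrow> bool" where
  "lower I \<longleftrightarrow> (\<forall>x\<in>{a..b}. \<forall>y\<in>{a..b}. x \<le> y \<longrightarrow> y \<in> I \<longrightarrow> x \<in> I)"

lemma lower_preimage: "lower I \<Longrightarrow> lower {x. drive f x z p \<in> I}"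
  unfolding lower_def using drive_in drive_mono by blast

lemma a_in: "a \<in> {a..b}" and b_in: "b \<in> {a..b}"
  using a_le_b by auto

definition joint :: "nat \<Rightarrow> real \<Rightarrow> 'z \<Rightarrow> real set \<Rightarrow> 'z set \<Rightarrow> real" where
  "joint t x z I B = measure_pmf.prob (chain_path K t z) {p. drive f x z p \<in> I \<and> last (z # p) \<in> B}"

text \<open>For lower sets this is the difference between the probabilities of \<open>I\<close> for the two extreme
  trajectories.\<close>

definition separation :: "nat \<Rightarrow> real set \<Rightarrow> real" where
  "separation t I = measure_pmf.prob (chain_path K t z0) {p. drive f a z0 p \<in> I \<and> drive f b z0 p \<notin> I}"

lemma joint_antimono:
  assumes "lower I" "x \<in> {a..b}" "y \<in> {a..b}" "x \<le> y"
  shows "joint t y z I B \<le> joint t x z I B"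
  unfolding joint_def
proof (rule measure_pmf.finite_measure_mono)
  show "{p. drive f y z p \<in> I \<and> last (z # p) \<in> B} \<subseteq> {p. drive f x z p \<in> I \<and> last (z # p) \<in> B}"
    using assms lower_preimage[OF assms(1)] unfolding lower_def by blast
qed simp

lemma joint_diff_le_separation:
  assumes "lower I" "x \<in> {a..b}" "y \<in> {a..b}"
  shows "\<bar>joint t x z0 I B - joint t y z0 I B\<bar> \<le> separation t I"
proof -
  have "joint t a z0 I B \<le> measure_pmf.prob (chain_path K t z0)
      ({p. drive f b z0 p \<in> I \<and> last (z0 # p) \<in> B} \<union> {p. drive f a z0 p \<in> I \<and> drive f b z0 p \<notin> I})"
    unfolding joint_def by (rule measure_pmf.finite_measure_mono) auto
  also have "\<dots> \<le> joint t b z0 I B + separation t I"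
    unfolding joint_def separation_def by (rule measure_subadditive) (auto simp: measure_pmf.emeasure_eq_measure)
  finally have "joint t a z0 I B \<le> joint t b z0 I B + separation t I" .
  moreover have "joint t b z0 I B \<le> joint t x z0 I B" "joint t x z0 I B \<le> joint t a z0 I B"
      "joint t b z0 I B \<le> joint t y z0 I B" "joint t y z0 I B \<le> joint t a z0 I B"
    using assms a_in b_in by (auto intro!: joint_antimono)
  ultimately show ?thesis by linarith
qed

text \<open>After the first visit the path starts afresh from \<open>z0\<close>, at an uncontrolled position in
  \<open>[a, b]\<close>; \<open>\<theta>\<close> measures how much that position matters.\<close>

lemma joint_first_visit_approx:
  assumes x: "x \<in> {a..b}"
    and L: "\<And>n x'. x' \<in> {a..b} \<Longrightarrow> \<bar>joint n x' z0 I B - L n\<bar> \<le> \<theta> n"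
  shows "\<bar>joint t x z I B - (\<Sum>s<t. (avoid K z0 s z - avoid K z0 (Suc s) z) * L (t - Suc s))\<bar>
    \<le> avoid K z0 t z + (\<Sum>s<t. (avoid K z0 s z - avoid K z0 (Suc s) z) * \<theta> (t - Suc s))"
proof -
  let ?E = "{p. drive f x z p \<in> I \<and> last (z # p) \<in> B}"
  let ?P = "\<lambda>s. measure_pmf (chain_path K (Suc s) z)"
  let ?V = "\<lambda>p. indicator {p. first_visit z0 p} p :: real"
  define J where "J s = (\<integral>p. ?V p * measure_pmf.prob (chain_path K (t - Suc s) z0) {q. p @ q \<in> ?E} \<partial>?P s)" for s
  have V: "(\<integral>p. ?V p * c \<partial>?P s) = (avoid K z0 s z - avoid K z0 (Suc s) z) * c" for s c
    by (simp add: prob_first_visit)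
  have piece: "\<bar>J s - (avoid K z0 s z - avoid K z0 (Suc s) z) * L (t - Suc s)\<bar>
      \<le> (avoid K z0 s z - avoid K z0 (Suc s) z) * \<theta> (t - Suc s)" for s
  proof -
    have int: "integrable (?P s) (\<lambda>p. ?V p * measure_pmf.prob (chain_path K (t - Suc s) z0) {q. p @ q \<in> ?E})"
      by (rule measure_pmf.integrable_const_bound[where B = 1]) (auto simp: indicator_def)
    have intc: "integrable (?P s) (\<lambda>p. ?V p * c)" for c
      by (rule measure_pmf.integrable_const_bound[where B = "\<bar>c\<bar>"]) (auto simp: indicator_def)
    have "J s - (avoid K z0 s z - avoid K z0 (Suc s) z) * L (t - Suc s) =
        (\<integral>p. ?V p * measure_pmf.prob (chain_path K (t - Suc s) z0) {q. p @ q \<in> ?E} - ?V p * L (t - Suc s) \<partial>?P s)"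
      unfolding J_def V[symmetric] by (rule Bochner_Integration.integral_diff[OF int intc, symmetric])
    also have "\<bar>\<dots>\<bar> \<le> (\<integral>p. \<bar>?V p * measure_pmf.prob (chain_path K (t - Suc s) z0) {q. p @ q \<in> ?E} - ?V p * L (t - Suc s)\<bar> \<partial>?P s)"
      by (rule integral_abs_bound)
    also have "\<dots> \<le> (\<integral>p. ?V p * \<theta> (t - Suc s) \<partial>?P s)"
    proof (rule integral_mono_AE[OF _ intc])
      show "integrable (?P s) (\<lambda>p. \<bar>?V p * measure_pmf.prob (chain_path K (t - Suc s) z0) {q. p @ q \<in> ?E} - ?V p * L (t - Suc s)\<bar>)"
        by (intro integrable_abs Bochner_Integration.integrable_diff int intc)
      show "AE p in ?P s. \<bar>?V p * measure_pmf.prob (chain_path K (t - Suc s) z0) {q. p @ q \<in> ?E} - ?V p * L (t - Suc s)\<bar> \<le> ?V p * \<theta> (t - Suc s)"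
      proof (intro AE_I2)
        fix p
        show "\<bar>?V p * measure_pmf.prob (chain_path K (t - Suc s) z0) {q. p @ q \<in> ?E} - ?V p * L (t - Suc s)\<bar> \<le> ?V p * \<theta> (t - Suc s)"
        proof (cases "first_visit z0 p")
          case True
          then have "last (z # p) = z0" by (simp add: first_visit_def)
          then have "measure_pmf.prob (chain_path K (t - Suc s) z0) {q. p @ q \<in> ?E} = joint (t - Suc s) (drive f x z p) z0 I B"
            by (simp add: joint_def drive_append last_Cons_append del: last.simps)
          then show ?thesis using L[OF drive_in[OF x], of "t - Suc s" z p] True by simp
        qed simp
      qed
    qed
    finally show ?thesis by (simp only: V)
  qed
  have "joint t x z I B = measure_pmf.prob (chain_path K t z) {r \<in> ?E. z0 \<notin> set r} + (\<Sum>s<t. J s)"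
    unfolding joint_def J_def by (rule first_visit_decomposition)
  then have "joint t x z I B - (\<Sum>s<t. (avoid K z0 s z - avoid K z0 (Suc s) z) * L (t - Suc s)) =
     measure_pmf.prob (chain_path K t z) {r \<in> ?E. z0 \<notin> set r} +
     (\<Sum>s<t. J s - (avoid K z0 s z - avoid K z0 (Suc s) z) * L (t - Suc s))"
    by (simp only: sum_subtractf)
  moreover have "measure_pmf.prob (chain_path K t z) {r \<in> ?E. z0 \<notin> set r} \<le> avoid K z0 t z"
    unfolding avoid_def by (rule measure_pmf.finite_measure_mono) auto
  moreover have "0 \<le> measure_pmf.prob (chain_path K t z) {r \<in> ?E. z0 \<notin> set r}" by simp
  moreover have "\<bar>\<Sum>s<t. J s - (avoid K z0 s z - avoid K z0 (Suc s) z) * L (t - Suc s)\<bar>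
      \<le> (\<Sum>s<t. (avoid K z0 s z - avoid K z0 (Suc s) z) * \<theta> (t - Suc s))"
    by (rule order_trans[OF sum_abs]) (intro sum_mono piece)
  ultimately show ?thesis by linarith
qed

end

section \<open>Contraction\<close>

text \<open>Both words have the same length, so that the two opposite cases of the contraction
  argument can be compared at one and the same time.\<close>

locale splitting_recursion = monotone_recursion K f a b z0
  for K :: "'z::countable \<Rightarrow> 'z pmf" and f a b z0 +
  fixes c :: real and N :: nat and lo hi :: "'z list"
  assumes lo: "lo \<in> set_pmf (chain_path K N z0)" "last (z0 # lo) = z0" "drive f b z0 lo \<le> c"
    and hi: "hi \<in> set_pmf (chain_path K N z0)" "last (z0 # hi) = z0" "c \<le> drive f a z0 hi"
    and c_in: "c \<in> {a..b}"
begin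

definition sep_at :: "nat \<Rightarrow> real set \<Rightarrow> 'z \<Rightarrow> ennreal" where
  "sep_at t I z = emeasure (chain_path K t z0)
     {p. drive f a z0 p \<in> I \<and> drive f b z0 p \<notin> I \<and> last (z0 # p) = z}"

text \<open>Extended reals avoid convergence conditions when the suprema are summed over all states.\<close>

definition max_sep :: "nat \<Rightarrow> 'z \<Rightarrow> ennreal" where
  "max_sep t z = (SUP I\<in>Collect lower. sep_at t I z)"

definition mass :: "nat \<Rightarrow> ennreal" where
  "mass t = (\<integral>\<^sup>+z. max_sep t z \<partial>count_space UNIV)"

definition weight :: real where
  "weight = min (pmf (chain_path K N z0) lo) (pmf (chain_path K N z0) hi)"

lemma weight_pos: "0 < weight"
  using lo(1) hi(1) by (auto simp: weight_def pmf_positive_iff)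

lemma sep_at_le_max_sep: "lower I \<Longrightarrow> sep_at t I z \<le> max_sep t z"
  unfolding max_sep_def by (rule SUP_upper) simp

lemma lower_empty: "lower {}"
  by (simp add: lower_def)

text \<open>If \<open>c \<in> I\<close>, then \<open>lo\<close> sends every point into \<open>I\<close>; otherwise \<open>hi\<close> sends every point outside.
  Either way no two trajectories are separated by the preimage of \<open>I\<close>.\<close>

lemma split_path_no_sep:
  assumes "lower I"
  obtains q where "weight \<le> pmf (chain_path K N z0) q" "last (z0 # q) = z0" "sep_at t {x. drive f x z0 q \<in> I} z = 0"
proof (cases "c \<in> I")
  case True
  have "drive f x z0 lo \<in> I" if "x \<in> {a..b}" for x
  proof -
    have "drive f x z0 lo \<le> c" using drive_mono[OF that b_in, of z0 lo] that lo(3) by auto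
    then show ?thesis using assms True c_in drive_in[OF that] by (auto simp: lower_def)
  qed
  then show thesis
    using drive_in[OF b_in]
    by (intro that[of lo] lo) (auto simp: weight_def sep_at_def)
next
  case False
  have "drive f x z0 hi \<notin> I" if "x \<in> {a..b}" for x
  proof -
    have "c \<le> drive f x z0 hi" using drive_mono[OF a_in that, of z0 hi] that hi(3) by auto
    then show ?thesis using assms False c_in drive_in[OF that, of z0 hi] unfolding lower_def by blast
  qed
  then show thesis
    using drive_in[OF a_in]
    by (intro that[of hi] hi) (auto simp: weight_def sep_at_def)
qed

text \<open>The event at time \<open>t + n\<close> is pulled back along the last \<open>n\<close> steps to an event at time \<open>t\<close>.\<close>

lemma sep_at_add:
  "sep_at (t + n) I z = (\<integral>\<^sup>+z'. \<integral>\<^sup>+q. indicator {z} (last (z' # q)) * sep_at t {x. drive f x z' q \<in> I} z'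
     \<partial>chain_path K n z' \<partial>count_space UNIV)"
proof -
  let ?E = "{p. drive f a z0 p \<in> I \<and> drive f b z0 p \<notin> I \<and> last (z0 # p) = z}"
  have "sep_at (t + n) I z = (\<integral>\<^sup>+r. indicator ?E (take t r @ drop t r) \<partial>chain_path K (t + n) z0)"
    unfolding sep_at_def append_take_drop_id by simp
  also have "\<dots> = (\<integral>\<^sup>+z'. \<integral>\<^sup>+q. \<integral>\<^sup>+p. indicator ?E (p @ q) * indicator {z'} (last (z0 # p))
      \<partial>chain_path K t z0 \<partial>chain_path K n z' \<partial>count_space UNIV)"
    by (rule nn_integral_path_cut)
  also have "\<dots> = (\<integral>\<^sup>+z'. \<integral>\<^sup>+q. indicator {z} (last (z' # q)) * sep_at t {x. drive f x z' q \<in> I} z'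
     \<partial>chain_path K n z' \<partial>count_space UNIV)"
  proof (intro nn_integral_cong)
    fix z' q
    have "(\<integral>\<^sup>+p. indicator ?E (p @ q) * indicator {z'} (last (z0 # p)) \<partial>chain_path K t z0) =
        (\<integral>\<^sup>+p. indicator {z} (last (z' # q)) *
          indicator {p. drive f a z0 p \<in> {x. drive f x z' q \<in> I} \<and> drive f b z0 p \<notin> {x. drive f x z' q \<in> I} \<and> last (z0 # p) = z'} p
          \<partial>chain_path K t z0)"
      by (intro nn_integral_cong) (auto simp: indicator_def drive_append last_Cons_append simp del: last.simps)
    also have "\<dots> = indicator {z} (last (z' # q)) * sep_at t {x. drive f x z' q \<in> I} z'"
      unfolding sep_at_def by (subst nn_integral_cmult) simp_all
    finally show "(\<integral>\<^sup>+p. indicator ?E (p @ q) * indicator {z'} (last (z0 # p)) \<partial>chain_path K t z0) =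
      indicator {z} (last (z' # q)) * sep_at t {x. drive f x z' q \<in> I} z'" .
  qed
  finally show ?thesis .
qed

text \<open>One term of the average on the right, the one belonging to the word without separation, is
  absent on the left.\<close>

lemma max_sep_contraction:
  "max_sep (t + N) z + ennreal weight * indicator {z0} z * max_sep t z0 \<le>
    (\<integral>\<^sup>+z'. \<integral>\<^sup>+q. indicator {z} (last (z' # q)) * max_sep t z' \<partial>measure_pmf (chain_path K N z') \<partial>count_space UNIV)"
    (is "_ + ?c \<le> ?R")
proof -
  have "sep_at (t + N) I z + ?c \<le> ?R" if I: "lower I" for I
  proof -
    obtain r where r: "weight \<le> pmf (chain_path K N z0) r" "last (z0 # r) = z0"
        "sep_at t {x. drive f x z0 r \<in> I} z0 = 0"
      using split_path_no_sep[OF I, of t z0] by blast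
    define k where "k z' q = indicator {z0} z' * (indicator {r} q * (indicator {z} z0 * max_sep t z0))" for z' q
    have "?c \<le> pmf (chain_path K N z0) r * (indicator {z} z0 * max_sep t z0)"
      using r(1) by (auto simp: indicator_def ennreal_leI intro!: mult_right_mono)
    also have "\<dots> = (\<integral>\<^sup>+q. indicator {r} q * (indicator {z} z0 * max_sep t z0) \<partial>measure_pmf (chain_path K N z0))"
      by (subst nn_integral_multc) (simp_all add: emeasure_pmf_single)
    also have "\<dots> = (\<integral>\<^sup>+z'. (\<integral>\<^sup>+q. indicator {r} q * (indicator {z} z0 * max_sep t z0) \<partial>measure_pmf (chain_path K N z')) * indicator {z0} z' \<partial>count_space UNIV)"
      by (simp add: nn_integral_indicator_singleton)
    also have "\<dots> = (\<integral>\<^sup>+z'. \<integral>\<^sup>+q. k z' q \<partial>measure_pmf (chain_path K N z') \<partial>count_space UNIV)"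
      by (intro nn_integral_cong) (simp add: k_def nn_integral_cmult mult.commute)
    finally have "sep_at (t + N) I z + ?c \<le> (\<integral>\<^sup>+z'. \<integral>\<^sup>+q. indicator {z} (last (z' # q)) * sep_at t {x. drive f x z' q \<in> I} z'
     \<partial>measure_pmf (chain_path K N z') \<partial>count_space UNIV) + (\<integral>\<^sup>+z'. \<integral>\<^sup>+q. k z' q \<partial>measure_pmf (chain_path K N z') \<partial>count_space UNIV)"
      unfolding sep_at_add by (rule add_left_mono)
    also have "\<dots> = (\<integral>\<^sup>+z'. \<integral>\<^sup>+q. indicator {z} (last (z' # q)) * sep_at t {x. drive f x z' q \<in> I} z' + k z' q
       \<partial>measure_pmf (chain_path K N z') \<partial>count_space UNIV)"
      by (simp add: nn_integral_add)
    also have "\<dots> \<le> ?R"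
    proof (intro nn_integral_mono)
      fix z' q
      show "indicator {z} (last (z' # q)) * sep_at t {x. drive f x z' q \<in> I} z' + k z' q
          \<le> indicator {z} (last (z' # q)) * max_sep t z'"
      proof (cases "z' = z0 \<and> q = r")
        case True
        then have "sep_at t {x. drive f x z' q \<in> I} z' = 0" "last (z' # q) = z0" using r by auto
        moreover have "k z' q = indicator {z} z0 * max_sep t z'" using True by (simp add: k_def)
        ultimately show ?thesis by (simp del: last.simps add: indicator_def)
      next
        case False
        then have "k z' q = 0" by (auto simp: k_def)
        then show ?thesis
          using sep_at_le_max_sep[OF lower_preimage[OF I], of t z' q z'] by (simp add: mult_left_mono)
      qed
    qed
    finally show ?thesis .
  qed
  then have "(SUP I\<in>Collect lower. sep_at (t + N) I z + ?c) \<le> ?R"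
    by (intro SUP_least) auto
  moreover have "(SUP I\<in>Collect lower. sep_at (t + N) I z + ?c) = max_sep (t + N) z + ?c"
    unfolding max_sep_def[of "t + N"] using lower_empty by (intro ennreal_SUP_add_left) auto
  ultimately show ?thesis by simp
qed

text \<open>Summed over the end states, the weights with which the kernel redistributes the mass of a
  state add up to one, so the only change is the loss at the atom.\<close>

lemma mass_contraction: "mass (t + N) + ennreal weight * max_sep t z0 \<le> mass t"
proof -
  have "mass (t + N) + ennreal weight * max_sep t z0 =
      mass (t + N) + (\<integral>\<^sup>+z. ennreal weight * max_sep t z0 * indicator {z0} z \<partial>count_space UNIV)"
    by (simp add: nn_integral_indicator_singleton)
  also have "\<dots> = (\<integral>\<^sup>+z. max_sep (t + N) z + ennreal weight * indicator {z0} z * max_sep t z0 \<partial>count_space UNIV)"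
    unfolding mass_def by (subst nn_integral_add[symmetric]) (auto intro!: nn_integral_cong simp: mult_ac)
  also have "\<dots> \<le> (\<integral>\<^sup>+z. \<integral>\<^sup>+z'. \<integral>\<^sup>+q. indicator {z} (last (z' # q)) * max_sep t z' \<partial>measure_pmf (chain_path K N z') \<partial>count_space UNIV \<partial>count_space UNIV)"
    by (intro nn_integral_mono max_sep_contraction)
  also have "\<dots> = (\<integral>\<^sup>+z'. \<integral>\<^sup>+z. \<integral>\<^sup>+q. indicator {z} (last (z' # q)) * max_sep t z' \<partial>measure_pmf (chain_path K N z') \<partial>count_space UNIV \<partial>count_space UNIV)"
    by (rule nn_integral_count_space_swap)
  also have "\<dots> = mass t"
    unfolding mass_def by (intro nn_integral_cong nn_integral_indicator_fibre)
  finally show ?thesis .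
qed

lemma mass_le_1: "mass t \<le> 1"
proof -
  have "sep_at t I z \<le> (\<integral>\<^sup>+p. indicator {z} (last (z0 # p)) * 1 \<partial>measure_pmf (chain_path K t z0))" for I z
  proof -
    have "sep_at t I z = (\<integral>\<^sup>+p. indicator {p. drive f a z0 p \<in> I \<and> drive f b z0 p \<notin> I \<and> last (z0 # p) = z} p \<partial>measure_pmf (chain_path K t z0))"
      by (simp add: sep_at_def)
    also have "\<dots> \<le> (\<integral>\<^sup>+p. indicator {z} (last (z0 # p)) * 1 \<partial>measure_pmf (chain_path K t z0))"
      by (intro nn_integral_mono) (auto simp: indicator_def)
    finally show ?thesis .
  qed
  then have "max_sep t z \<le> (\<integral>\<^sup>+p. indicator {z} (last (z0 # p)) * 1 \<partial>measure_pmf (chain_path K t z0))" for z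
    unfolding max_sep_def by (rule SUP_least)
  then have "mass t \<le> (\<integral>\<^sup>+z. \<integral>\<^sup>+p. indicator {z} (last (z0 # p)) * 1 \<partial>measure_pmf (chain_path K t z0) \<partial>count_space UNIV)"
    unfolding mass_def by (rule nn_integral_mono)
  also have "\<dots> = 1" by (rule nn_integral_indicator_fibre)
  finally show ?thesis .
qed

lemma max_sep_le_1: "max_sep t z \<le> 1"
  unfolding max_sep_def sep_at_def by (intro SUP_least measure_pmf.emeasure_le_1)

text \<open>The mass lost between times \<open>t\<close> and \<open>t + N\<close> telescopes along each residue class modulo \<open>N\<close>. The sum
  over a window of length \<open>N\<close> treats all classes at once.\<close>

lemma sum_max_sep_le: "(\<Sum>t<n. ennreal weight * max_sep t z0) + (\<Sum>i<N. mass (n + i)) \<le> N"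
proof (induction n)
  case 0
  have "(\<Sum>i<N. mass i) \<le> (\<Sum>i<N. 1)" by (intro sum_mono mass_le_1)
  then show ?case by (simp add: ennreal_of_nat_eq_real_of_nat)
next
  case (Suc n)
  have shift: "(\<Sum>i<N. mass (Suc n + i)) + mass n = (\<Sum>i<N. mass (n + i)) + mass (n + N)"
    using sum.lessThan_Suc_shift[of "\<lambda>i. mass (n + i)" N] by (simp add: add.commute)
  have "mass n \<noteq> \<infinity>" using mass_le_1[of n] by (auto simp: top_unique)
  have "(\<Sum>t<Suc n. ennreal weight * max_sep t z0) + (\<Sum>i<N. mass (Suc n + i)) + mass n =
      (\<Sum>t<n. ennreal weight * max_sep t z0) + (\<Sum>i<N. mass (n + i)) + (mass (n + N) + ennreal weight * max_sep n z0)"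
    by (simp only: add.assoc shift) (simp add: ac_simps)
  also have "\<dots> \<le> N + mass n"
    by (intro add_mono Suc mass_contraction)
  finally show ?case
    using \<open>mass n \<noteq> \<infinity>\<close> by (simp add: add.commute[of _ "mass n"] ennreal_add_left_cancel_le)
qed

definition atom_sep :: "nat \<Rightarrow> real" where "atom_sep t = enn2real (max_sep t z0)"

lemma ennreal_atom_sep: "ennreal (atom_sep t) = max_sep t z0"
  using max_sep_le_1[of t z0] unfolding atom_sep_def by (intro ennreal_enn2real) (auto intro: le_less_trans)

lemma atom_sep_nonneg: "0 \<le> atom_sep t"
  by (simp add: atom_sep_def)

lemma summable_atom_sep: "summable atom_sep"
proof (rule summableI_nonneg_bounded)
  fix n
  have "ennreal (\<Sum>t<n. weight * atom_sep t) = (\<Sum>t<n. ennreal weight * max_sep t z0)"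
    using weight_pos by (simp add: sum_ennreal[symmetric] atom_sep_nonneg ennreal_mult ennreal_atom_sep)
  also have "\<dots> \<le> N"
    by (rule order_trans[OF _ sum_max_sep_le[of n]]) simp
  finally have "(\<Sum>t<n. weight * atom_sep t) \<le> N"
    by (simp add: ennreal_of_nat_eq_real_of_nat)
  then show "sum atom_sep {..<n} \<le> N / weight"
    using weight_pos by (simp add: field_simps flip: sum_distrib_left)
qed (rule atom_sep_nonneg)

lemma last_visit_cases:
  obtains j where "j \<le> length r" "last (z0 # take (length r - j) r) = z0" "z0 \<notin> set (drop (length r - j) r)"
proof (cases "z0 \<in> set r")
  case True
  then obtain ys zs where "r = ys @ z0 # zs" "z0 \<notin> set zs" by (meson split_list_last)
  then show thesis by (intro that[of "length zs"]) auto
next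
  case False
  then show thesis by (intro that[of "length r"]) auto
qed

text \<open>Union bound over the time \<open>t - j\<close> of the last visit to \<open>z0\<close>: the stretch after it avoids \<open>z0\<close>, and
  the event pulled back along it is again given by a lower set.\<close>

lemma separation_le:
  assumes I: "lower I"
  shows "separation t I \<le> (\<Sum>j\<le>t. avoid K z0 j z0 * atom_sep (t - j))"
proof -
  define E where "E = {r. drive f a z0 r \<in> I \<and> drive f b z0 r \<notin> I}"
  define V where "V j = {r. last (z0 # take (t - j) r) = z0 \<and> z0 \<notin> set (drop (t - j) r) \<and> r \<in> E}" for j
  have V: "emeasure (chain_path K t z0) (V j) \<le> ennreal (avoid K z0 j z0 * atom_sep (t - j))" if j: "j \<le> t" for j
  proof -
    define h :: "'z list \<Rightarrow> 'z list \<Rightarrow> ennreal"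
      where "h p q = indicator {r. last (z0 # p) = z0 \<and> z0 \<notin> set q \<and> r \<in> E} (p @ q)" for p q
    have "emeasure (chain_path K t z0) (V j) = (\<integral>\<^sup>+r. h (take (t - j) r) (drop (t - j) r) \<partial>measure_pmf (chain_path K ((t - j) + j) z0))"
      using j by (simp add: h_def V_def indicator_def flip: nn_integral_indicator del: last.simps)
    also have "\<dots> = (\<integral>\<^sup>+z'. \<integral>\<^sup>+q. \<integral>\<^sup>+p. h p q * indicator {z'} (last (z0 # p)) \<partial>measure_pmf (chain_path K (t - j) z0)
        \<partial>measure_pmf (chain_path K j z') \<partial>count_space UNIV)"
      by (rule nn_integral_path_cut)
    also have "\<dots> \<le> (\<integral>\<^sup>+z'. (\<integral>\<^sup>+q. indicator {q. z0 \<notin> set q} q * max_sep (t - j) z0 \<partial>measure_pmf (chain_path K j z')) * indicator {z0} z' \<partial>count_space UNIV)"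
    proof (intro nn_integral_mono)
      fix z'
      have "(\<integral>\<^sup>+p. h p q * indicator {z'} (last (z0 # p)) \<partial>measure_pmf (chain_path K (t - j) z0))
          \<le> indicator {q. z0 \<notin> set q} q * max_sep (t - j) z0 * indicator {z0} z'" for q
      proof (cases "z' = z0 \<and> z0 \<notin> set q")
        case True
        have "(\<integral>\<^sup>+p. h p q * indicator {z'} (last (z0 # p)) \<partial>measure_pmf (chain_path K (t - j) z0)) =
          (\<integral>\<^sup>+p. indicator {p. drive f a z0 p \<in> {x. drive f x z0 q \<in> I} \<and> drive f b z0 p \<notin> {x. drive f x z0 q \<in> I} \<and> last (z0 # p) = z0} p
            \<partial>measure_pmf (chain_path K (t - j) z0))"
          using True by (intro nn_integral_cong) (auto simp: h_def E_def indicator_def drive_append simp del: last.simps)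
        also have "\<dots> = sep_at (t - j) {x. drive f x z0 q \<in> I} z0"
          by (simp add: sep_at_def)
        also have "\<dots> \<le> max_sep (t - j) z0"
          by (intro sep_at_le_max_sep lower_preimage I)
        finally show ?thesis using True by simp
      next
        case False
        then have "h p q * indicator {z'} (last (z0 # p)) = 0" for p
          by (auto simp: h_def indicator_def simp del: last.simps)
        then show ?thesis by (simp del: last.simps mult_eq_0_iff)
      qed
      then have "(\<integral>\<^sup>+q. \<integral>\<^sup>+p. h p q * indicator {z'} (last (z0 # p)) \<partial>measure_pmf (chain_path K (t - j) z0) \<partial>measure_pmf (chain_path K j z'))
          \<le> (\<integral>\<^sup>+q. indicator {q. z0 \<notin> set q} q * max_sep (t - j) z0 * indicator {z0} z' \<partial>measure_pmf (chain_path K j z'))"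
        by (rule nn_integral_mono)
      also have "\<dots> = (\<integral>\<^sup>+q. indicator {q. z0 \<notin> set q} q * max_sep (t - j) z0 \<partial>measure_pmf (chain_path K j z')) * indicator {z0} z'"
        by (rule nn_integral_multc) simp
      finally show "(\<integral>\<^sup>+q. \<integral>\<^sup>+p. h p q * indicator {z'} (last (z0 # p)) \<partial>measure_pmf (chain_path K (t - j) z0) \<partial>measure_pmf (chain_path K j z'))
          \<le> (\<integral>\<^sup>+q. indicator {q. z0 \<notin> set q} q * max_sep (t - j) z0 \<partial>measure_pmf (chain_path K j z')) * indicator {z0} z'" .
    qed
    also have "\<dots> = emeasure (chain_path K j z0) {q. z0 \<notin> set q} * max_sep (t - j) z0"
      by (simp add: nn_integral_indicator_singleton nn_integral_multc)
    also have "\<dots> = ennreal (avoid K z0 j z0 * atom_sep (t - j))"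
      by (simp add: avoid_def measure_pmf.emeasure_eq_measure ennreal_mult atom_sep_nonneg ennreal_atom_sep)
    finally show ?thesis .
  qed
  have "separation t I \<le> measure_pmf.prob (chain_path K t z0) (\<Union>j\<le>t. V j)"
    unfolding separation_def
  proof (intro measure_pmf.finite_measure_mono_AE AE_pmfI impI)
    fix r assume "r \<in> set_pmf (chain_path K t z0)"
    then have len: "length r = t" by (rule length_path)
    assume "r \<in> {p. drive f a z0 p \<in> I \<and> drive f b z0 p \<notin> I}"
    then have "r \<in> E" by (simp add: E_def)
    obtain j where "j \<le> t" "last (z0 # take (t - j) r) = z0" "z0 \<notin> set (drop (t - j) r)"
      using last_visit_cases[of r] unfolding len by blast
    then show "r \<in> (\<Union>j\<le>t. V j)" using \<open>r \<in> E\<close> unfolding V_def by blast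
  qed simp
  also have "\<dots> \<le> (\<Sum>j\<le>t. measure_pmf.prob (chain_path K t z0) (V j))"
    by (rule measure_pmf.finite_measure_subadditive_finite) auto
  also have "\<dots> \<le> (\<Sum>j\<le>t. avoid K z0 j z0 * atom_sep (t - j))"
    using V by (intro sum_mono) (simp add: measure_pmf.emeasure_eq_measure avoid_nonneg atom_sep_nonneg)
  finally show ?thesis .
qed

end

section \<open>Convergence from every starting point\<close>

locale ergodic_recursion = splitting_recursion K f a b z0 c N lo hi
  for K :: "'z::countable \<Rightarrow> 'z pmf" and f a b z0 c N lo hi +
  assumes hit: "(\<lambda>t. avoid K z0 t z) \<longlonglongrightarrow> 0"
    and finite_mean: "summable (\<lambda>t. avoid K z0 t z0)"
    and aperiodic: "Gcd {Suc s |s. avoid K z0 (Suc s) z0 < avoid K z0 s z0} = 1"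
begin

sublocale atom: renewal "\<lambda>t. avoid K z0 t z0"
  by unfold_locales (auto simp: avoid_nonneg avoid_Suc_le finite_mean aperiodic)

text \<open>The bound on the separation that does not depend on the lower set.\<close>

definition sep_bound :: "nat \<Rightarrow> real" where
  "sep_bound t = (\<Sum>j\<le>t. avoid K z0 j z0 * atom_sep (t - j))"

lemma summable_sep_bound: "summable sep_bound"
  unfolding sep_bound_def[abs_def]
  by (rule summable_Cauchy_product) (simp_all add: avoid_nonneg finite_mean atom_sep_nonneg summable_atom_sep)

lemma sep_bound_nonneg: "0 \<le> sep_bound t"
  unfolding sep_bound_def by (intro sum_nonneg mult_nonneg_nonneg avoid_nonneg atom_sep_nonneg)

lemma joint_diff_le_sep_bound:
  "lower I \<Longrightarrow> x \<in> {a..b} \<Longrightarrow> y \<in> {a..b} \<Longrightarrow> \<bar>joint t x z0 I B - joint t y z0 I B\<bar> \<le> sep_bound t"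
  using joint_diff_le_separation[of I x y t B] separation_le[of I t] by (simp add: sep_bound_def)

definition limit :: "real set \<Rightarrow> 'z set \<Rightarrow> real" where
  "limit I B = lim (\<lambda>t. joint t a z0 I B)"

lemma joint_bounds: "0 \<le> joint t x z I B" "joint t x z I B \<le> 1"
  by (simp_all add: joint_def)

text \<open>Replacing the position at the first return by \<open>a\<close> turns the first-visit decomposition into a
  renewal equation whose inhomogeneity is dominated by the summable sequence \<open>g\<close>.\<close>

lemma uniform_limit_from_atom:
  obtains \<theta> where "\<theta> \<longlonglongrightarrow> 0" and "\<And>t. 0 \<le> \<theta> t"
    and "\<And>t x I B. lower I \<Longrightarrow> x \<in> {a..b} \<Longrightarrow> \<bar>joint t x z0 I B - limit I B\<bar> \<le> \<theta> t"
proof -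
  define g where "g t = avoid K z0 t z0 + (\<Sum>s<t. atom.\<phi> s * sep_bound (t - Suc s))" for t
  have "summable (\<lambda>n. \<Sum>s\<le>n. atom.\<phi> s * sep_bound (n - s))"
    by (rule summable_Cauchy_product)
      (use atom.summable_abs_phi summable_sep_bound in \<open>simp_all add: sep_bound_nonneg\<close>)
  then have "summable (\<lambda>n. \<Sum>s<Suc n. atom.\<phi> s * sep_bound (Suc n - Suc s))"
    by (simp add: lessThan_Suc_atMost)
  then have "summable (\<lambda>t. \<Sum>s<t. atom.\<phi> s * sep_bound (t - Suc s))"
    by (subst (asm) summable_Suc_iff)
  then have "summable g"
    unfolding g_def[abs_def] by (intro summable_add finite_mean)
  then obtain \<theta> where \<theta>: "\<theta> \<longlonglongrightarrow> 0"
    and approx: "\<And>x e. (\<And>t. x t = e t + (\<Sum>s<t. atom.\<phi> s * x (t - Suc s))) \<Longrightarrow> (\<And>t. \<bar>e t\<bar> \<le> g t) \<Longrightarrow>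
      (\<exists>L. \<forall>t. \<bar>x t - L\<bar> \<le> \<theta> t)"
    using atom.renewal_equation_uniform_limit[of g] by blast
  have a: "\<bar>joint t a z0 I B - limit I B\<bar> \<le> \<theta> t" if I: "lower I" for I B t
  proof -
    define e where "e t = joint t a z0 I B - (\<Sum>s<t. atom.\<phi> s * joint (t - Suc s) a z0 I B)" for t
    have "\<bar>e t\<bar> \<le> g t" for t
      using joint_first_visit_approx[OF a_in, of I B "\<lambda>n. joint n a z0 I B" sep_bound t z0] joint_diff_le_sep_bound[OF I _ a_in]
      by (simp add: e_def g_def atom.\<phi>_def)
    then obtain L where L: "\<And>t. \<bar>joint t a z0 I B - L\<bar> \<le> \<theta> t"
      using approx[of "\<lambda>t. joint t a z0 I B" e] by (auto simp: e_def)
    have "(\<lambda>t. joint t a z0 I B - L) \<longlonglongrightarrow> 0"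
      by (rule Lim_null_comparison[OF _ \<theta>]) (simp add: L)
    then have "(\<lambda>t. joint t a z0 I B) \<longlonglongrightarrow> L" by (simp add: LIM_zero_iff)
    then show ?thesis using L unfolding limit_def by (simp add: limI)
  qed
  show thesis
  proof (rule that[of "\<lambda>t. \<theta> t + sep_bound t"])
    show "(\<lambda>t. \<theta> t + sep_bound t) \<longlonglongrightarrow> 0"
      using tendsto_add[OF \<theta> summable_LIMSEQ_zero[OF summable_sep_bound]] by simp
    show bound: "\<bar>joint t x z0 I B - limit I B\<bar> \<le> \<theta> t + sep_bound t" if "lower I" "x \<in> {a..b}" for t x I B
      using a[OF that(1), of t B] joint_diff_le_sep_bound[OF that a_in, of t B] by linarith
    show "0 \<le> \<theta> t + sep_bound t" for t
      using bound[OF lower_empty a_in, of t UNIV] by linarith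
  qed
qed

lemma limit_bounds:
  assumes "lower I" shows "0 \<le> limit I B" "limit I B \<le> 1"
proof -
  obtain \<theta> where \<theta>: "\<theta> \<longlonglongrightarrow> 0" and "\<And>t. 0 \<le> \<theta> t"
    and unif: "\<And>t x I B. lower I \<Longrightarrow> x \<in> {a..b} \<Longrightarrow> \<bar>joint t x z0 I B - limit I B\<bar> \<le> \<theta> t"
    using uniform_limit_from_atom by blast
  have "(\<lambda>t. joint t a z0 I B - limit I B) \<longlonglongrightarrow> 0"
    by (rule Lim_null_comparison[OF _ \<theta>]) (simp add: unif[OF assms a_in])
  then have "(\<lambda>t. joint t a z0 I B) \<longlonglongrightarrow> limit I B" by (simp add: LIM_zero_iff)
  then show "0 \<le> limit I B" "limit I B \<le> 1"
    by (auto intro: LIMSEQ_le_const LIMSEQ_le_const2 joint_bounds)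
qed

text \<open>Before the first visit to \<open>z0\<close> nothing is known, but this has vanishing probability;
  afterwards the limit from the atom applies. Dominated convergence averages over the start.\<close>

theorem uniform_limit_from_law:
  fixes \<nu> :: "'z pmf"
  obtains \<kappa> where "\<kappa> \<longlonglongrightarrow> 0"
    and "\<And>t x I B. lower I \<Longrightarrow> x \<in> {a..b} \<Longrightarrow> \<bar>(\<integral>z. joint t x z I B \<partial>\<nu>) - limit I B\<bar> \<le> \<kappa> t"
proof -
  obtain \<theta> where \<theta>: "\<theta> \<longlonglongrightarrow> 0" and \<theta>_nonneg: "\<And>t. 0 \<le> \<theta> t"
    and unif: "\<And>t x I B. lower I \<Longrightarrow> x \<in> {a..b} \<Longrightarrow> \<bar>joint t x z0 I B - limit I B\<bar> \<le> \<theta> t"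
    using uniform_limit_from_atom by blast
  obtain C where C: "\<And>t. \<theta> t \<le> C"
    using convergent_imp_Bseq[OF convergentI[OF \<theta>]] by (auto simp: Bseq_def abs_le_iff)
  define \<psi> where "\<psi> s z = avoid K z0 s z - avoid K z0 (Suc s) z" for s z
  have \<psi>_nonneg: "0 \<le> \<psi> s z" for s z by (simp add: \<psi>_def avoid_Suc_le)
  have sum_\<psi>: "(\<Sum>s<t. \<psi> s z) = 1 - avoid K z0 t z" for t z
    using sum_lessThan_telescope'[of "\<lambda>s. avoid K z0 s z" t] by (simp add: \<psi>_def)
  define \<kappa> where "\<kappa> t z = 2 * avoid K z0 t z + (\<Sum>s<t. \<psi> s z * \<theta> (t - Suc s))" for t z
  have \<kappa>: "\<bar>joint t x z I B - limit I B\<bar> \<le> \<kappa> t z" if I: "lower I" and x: "x \<in> {a..b}" for t x z I B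
  proof -
    have "\<bar>joint t x z I B - (\<Sum>s<t. \<psi> s z * limit I B)\<bar> \<le> avoid K z0 t z + (\<Sum>s<t. \<psi> s z * \<theta> (t - Suc s))"
      unfolding \<psi>_def by (rule joint_first_visit_approx[OF x]) (rule unif[OF I])
    moreover have "(\<Sum>s<t. \<psi> s z * limit I B) = limit I B - avoid K z0 t z * limit I B"
      unfolding sum_distrib_right[symmetric] sum_\<psi> by (simp add: left_diff_distrib)
    moreover have "0 \<le> avoid K z0 t z * limit I B" "avoid K z0 t z * limit I B \<le> avoid K z0 t z"
      using limit_bounds[OF I, of B] avoid_nonneg[of K z0 t z]
      by (auto intro: mult_left_le)
    ultimately show ?thesis unfolding \<kappa>_def by linarith
  qed
  have avoid_le_1: "avoid K z0 t z \<le> 1" for t z by (simp add: avoid_def)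
  have \<kappa>_nonneg: "0 \<le> \<kappa> t z" for t z
    unfolding \<kappa>_def by (intro add_nonneg_nonneg mult_nonneg_nonneg sum_nonneg avoid_nonneg \<psi>_nonneg \<theta>_nonneg) simp
  have \<kappa>_bound: "\<kappa> t z \<le> 2 + C" for t z
  proof -
    have "(\<Sum>s<t. \<psi> s z * \<theta> (t - Suc s)) \<le> (\<Sum>s<t. \<psi> s z * C)"
      by (intro sum_mono mult_left_mono C \<psi>_nonneg)
    also have "\<dots> = (1 - avoid K z0 t z) * C" by (simp add: sum_\<psi> flip: sum_distrib_right)
    also have "\<dots> \<le> 1 * C"
      using avoid_nonneg[of K z0 t z] C[of 0] \<theta>_nonneg[of 0] by (intro mult_right_mono) auto
    finally show ?thesis using avoid_le_1[of t z] by (simp add: \<kappa>_def)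
  qed
  have \<kappa>_lim: "(\<lambda>t. \<kappa> t z) \<longlonglongrightarrow> 0" for z
  proof -
    have "(\<lambda>s. \<psi> s z) sums (1 - 0)"
      using telescope_sums'[OF hit[of z]] by (simp add: \<psi>_def)
    then have "summable (\<lambda>s. \<bar>\<psi> s z\<bar>)" by (simp add: \<psi>_nonneg sums_iff)
    then have "(\<lambda>t. \<Sum>s<t. \<psi> s z * \<theta> (t - Suc s)) \<longlonglongrightarrow> 0"
      by (rule convolution_shift_tendsto_0) (rule \<theta>)
    then show ?thesis
      unfolding \<kappa>_def[abs_def] using tendsto_add[OF tendsto_mult_right_zero[OF hit[of z], of 2]] by fastforce
  qed
  have int_\<kappa>: "integrable \<nu> (\<kappa> t)" for t
    by (rule measure_pmf.integrable_const_bound[where B = "2 + C"]) (auto simp: \<kappa>_nonneg \<kappa>_bound)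
  show thesis
  proof (rule that)
    have "(\<lambda>t. \<integral>z. \<kappa> t z \<partial>\<nu>) \<longlonglongrightarrow> (\<integral>z. 0 \<partial>\<nu>)"
      by (rule integral_dominated_convergence[where w = "\<lambda>_. 2 + C"])
        (auto simp: \<kappa>_nonneg \<kappa>_bound \<kappa>_lim)
    then show "(\<lambda>t. \<integral>z. \<kappa> t z \<partial>\<nu>) \<longlonglongrightarrow> 0" by simp
  next
    fix t x I B assume I: "lower I" and x: "x \<in> {a..b}"
    have int: "integrable \<nu> (\<lambda>z. joint t x z I B)"
      by (rule measure_pmf.integrable_const_bound[where B = 1]) (auto simp: joint_bounds)
    have "(\<integral>z. joint t x z I B \<partial>\<nu>) - limit I B = (\<integral>z. joint t x z I B - limit I B \<partial>\<nu>)"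
      using int by simp
    also have "\<bar>\<dots>\<bar> \<le> (\<integral>z. \<bar>joint t x z I B - limit I B\<bar> \<partial>\<nu>)"
      by (rule integral_abs_bound)
    also have "\<dots> \<le> (\<integral>z. \<kappa> t z \<partial>\<nu>)"
      using int by (intro integral_mono int_\<kappa>) (auto simp: \<kappa>[OF I x])
    finally show "\<bar>(\<integral>z. joint t x z I B \<partial>\<nu>) - limit I B\<bar> \<le> (\<integral>z. \<kappa> t z \<partial>\<nu>)" .
  qed
qed

end

section \<open>Uniform limits of discrete laws\<close>

text \<open>Right-continuity in \<open>y\<close> and countable additivity in \<open>B\<close> pass to uniform limits. Hence
  each slice \<open>L \<cdot> {z}\<close> is, up to the factor \<open>h z\<close>, a distribution function, and \<open>Q\<close> is built by drawing
  \<open>z\<close> with weights \<open>h\<close> and then the real coordinate from the normalised slice.\<close>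

theorem uniform_limit_of_laws:
  fixes P :: "nat \<Rightarrow> (real \<times> 'z::countable) pmf" and L :: "real \<Rightarrow> 'z set \<Rightarrow> real"
  assumes support: "\<And>t. set_pmf (P t) \<subseteq> {a..b} \<times> UNIV"
    and \<theta>: "\<theta> \<longlonglongrightarrow> 0"
    and approx: "\<And>t y B. \<bar>measure (P t) ({..y} \<times> B) - L y B\<bar> \<le> \<theta> t"
  obtains Q where "prob_space Q" and "sets Q = sets (borel \<Otimes>\<^sub>M count_space UNIV)"
    and "\<And>y B. measure Q ({..y} \<times> B) = L y B" and "\<And>B. measure Q (UNIV \<times> B) = L b B"
proof -
  have lim: "(\<lambda>t. measure (P t) ({..y} \<times> B)) \<longlonglongrightarrow> L y B" for y B
  proof -
    have "(\<lambda>t. measure (P t) ({..y} \<times> B) - L y B) \<longlonglongrightarrow> 0"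
      by (rule Lim_null_comparison[OF _ \<theta>]) (simp add: approx)
    then show ?thesis by (simp add: LIM_zero_iff)
  qed
  have mono: "L x A \<le> L y B" if "x \<le> y" "A \<subseteq> B" for x y A B
    using that by (intro LIMSEQ_le[OF lim lim] exI[of _ 0] allI impI measure_pmf.finite_measure_mono) auto
  have nonneg: "0 \<le> L y B" for y B
    by (rule LIMSEQ_le_const[OF lim]) auto
  have supp: "measure (P t) A = measure (P t) A'" if "A \<inter> {a..b} \<times> UNIV = A' \<inter> {a..b} \<times> UNIV" for t A A'
    using support[of t] that by (intro measure_pmf.finite_measure_eq_AE AE_pmfI) auto
  have below: "L y B = 0" if "y < a" for y B
  proof -
    have "measure (P t) ({..y} \<times> B) = measure (P t) {}" for t
      using that by (intro supp) auto
    then show ?thesis using lim[of y B] by (simp add: LIMSEQ_const_iff)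
  qed
  have above: "L y B = L b B" if "b \<le> y" for y B
  proof -
    have "measure (P t) ({..y} \<times> B) = measure (P t) ({..b} \<times> B)" for t
      using that by (intro supp) auto
    then show ?thesis using lim[of y B] lim[of b B] by (simp add: LIMSEQ_unique)
  qed
  have add: "L y (A \<union> B) = L y A + L y B" if "A \<inter> B = {}" for y A B
  proof -
    have "measure (P t) ({..y} \<times> (A \<union> B)) = measure (P t) ({..y} \<times> A) + measure (P t) ({..y} \<times> B)" for t
      using that unfolding Sigma_Un_distrib2 Times_Un_distrib1
      by (intro measure_pmf.finite_measure_Union) (auto simp: Sigma_Un_distrib2)
    then show ?thesis using tendsto_add[OF lim[of y A] lim[of y B]] lim[of y "A \<union> B"]
      by (simp add: LIMSEQ_unique)
  qed
  have fin_add: "L y F = (\<Sum>z\<in>F. L y {z})" if "finite F" for y F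
    using that
  proof (induction F)
    case empty
    show ?case using add[of "{}" "{}" y] by simp
  next
    case (insert z F)
    then show ?case using add[of "{z}" F y] by simp
  qed
  have total: "L b UNIV = 1"
  proof -
    have "measure (P t) ({..b} \<times> UNIV) = measure (P t) UNIV" for t by (intro supp) auto
    then show ?thesis using lim[of b UNIV] by (simp add: LIMSEQ_const_iff)
  qed

  \<comment> \<open>Finite sets exhausting the countable space reduce statements about arbitrary \<open>B\<close> to single points.\<close>
  define F :: "nat \<Rightarrow> 'z set" where "F n = {z. to_nat z < n}" for n
  have F_fin: "finite (F n)" for n
  proof -
    have "F n = to_nat -` {..<n}" by (auto simp: F_def)
    then show ?thesis using finite_vimageI[of "{..<n}" "to_nat :: 'z \<Rightarrow> nat"] by simp
  qed
  have F_inc: "incseq F" by (auto simp: incseq_def F_def)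
  have F_UN: "(\<Union>n. F n) = UNIV" by (auto simp: F_def)
  have exhaust: "(\<lambda>n. L y (B \<inter> F n)) \<longlonglongrightarrow> L y B" for y B
  proof (rule tendstoI)
    fix \<epsilon> :: real assume \<epsilon>: "\<epsilon> > 0"
    obtain t where t: "\<theta> t < \<epsilon> / 2"
      using order_tendstoD(2)[OF \<theta>, of "\<epsilon> / 2"] \<epsilon> by (auto simp: eventually_sequentially)
    have "(\<lambda>n. measure (P t) ({..y} \<times> (B - F n))) \<longlonglongrightarrow> measure (P t) (\<Inter>n. {..y} \<times> (B - F n))"
      using F_inc by (intro measure_pmf.finite_Lim_measure_decseq) (auto simp: decseq_def incseq_def)
    also have "(\<Inter>n. {..y} \<times> (B - F n)) = {}" using F_UN by auto
    finally have "\<forall>\<^sub>F n in sequentially. measure (P t) ({..y} \<times> (B - F n)) < \<epsilon> / 2"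
      using \<epsilon> by (intro order_tendstoD(2)[of _ 0]) auto
    then show "\<forall>\<^sub>F n in sequentially. dist (L y (B \<inter> F n)) (L y B) < \<epsilon>"
    proof eventually_elim
      case (elim n)
      have "L y B = L y (B \<inter> F n) + L y (B - F n)"
        using add[of "B \<inter> F n" "B - F n" y] by (simp add: Int_Diff_Un Int_Diff_disjoint)
      then show ?case
        using elim t approx[of t y "B - F n"] nonneg[of y "B - F n"]
        unfolding dist_real_def by linarith
    qed
  qed

  have right_cont: "continuous (at_right y) (\<lambda>y. L y B)" for y B
  proof (subst continuous_at_right_real_increasing)
    show "\<forall>\<epsilon>>0. \<exists>\<delta>>0. L (y + \<delta>) B - L y B < \<epsilon>"
    proof (intro allI impI)
      fix \<epsilon> :: real assume \<epsilon>: "\<epsilon> > 0"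
      obtain t where t: "\<theta> t < \<epsilon> / 3"
        using order_tendstoD(2)[OF \<theta>, of "\<epsilon> / 3"] \<epsilon> by (auto simp: eventually_sequentially)
      have "(\<lambda>n. measure (P t) ({..y + 1 / real (Suc n)} \<times> B)) \<longlonglongrightarrow> measure (P t) (\<Inter>n. {..y + 1 / real (Suc n)} \<times> B)"
      proof (intro measure_pmf.finite_Lim_measure_decseq)
        have "y + 1 / real (Suc n) \<le> y + 1 / real (Suc m)" if "m \<le> n" for m n
          using that by (simp add: frac_le)
        then show "decseq (\<lambda>n. {..y + 1 / real (Suc n)} \<times> B)"
          unfolding decseq_def by (meson Sigma_mono atMost_subset_iff order_refl)
      qed simp
      also have "(\<Inter>n. {..y + 1 / real (Suc n)} \<times> B) = {..y} \<times> B"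
      proof -
        have le: "x \<le> y" if "\<And>n. x \<le> y + 1 / real (Suc n)" for x
        proof (rule field_le_epsilon)
          fix e :: real assume "e > 0"
          then obtain n where "1 / real (Suc n) < e" using nat_approx_posE by blast
          then show "x \<le> y + e" using that[of n] by linarith
        qed
        show ?thesis
        proof (intro equalityI subsetI)
          fix w assume w: "w \<in> (\<Inter>n. {..y + 1 / real (Suc n)} \<times> B)"
          then have "fst w \<le> y" by (intro le) auto
          then show "w \<in> {..y} \<times> B" using w by (cases w) auto
        next
          fix w assume w: "w \<in> {..y} \<times> B"
          have "fst w \<le> y + 1 / real (Suc n)" for n
            by (rule order_trans[of _ y]) (use w in auto)
          then show "w \<in> (\<Inter>n. {..y + 1 / real (Suc n)} \<times> B)" using w by (cases w) auto
        qed
      qed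
      finally have "\<forall>\<^sub>F n in sequentially. measure (P t) ({..y + 1 / real (Suc n)} \<times> B) < measure (P t) ({..y} \<times> B) + \<epsilon> / 3"
        using \<epsilon> by (intro order_tendstoD(2)) auto
      then obtain n where "measure (P t) ({..y + 1 / real (Suc n)} \<times> B) < measure (P t) ({..y} \<times> B) + \<epsilon> / 3"
        using eventually_happens'[OF sequentially_bot] by blast
      then have "L (y + 1 / real (Suc n)) B - L y B < \<epsilon>"
        using t approx[of t "y + 1 / real (Suc n)" B] approx[of t y B] by linarith
      then show "\<exists>\<delta>>0. L (y + \<delta>) B - L y B < \<epsilon>"
        by (intro exI[of _ "1 / real (Suc n)"]) auto
    qed
  qed (rule mono; simp)

  define h where "h z = L b {z}" for z
  have h_nonneg: "0 \<le> h z" for z by (simp add: h_def nonneg)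
  have "(\<integral>\<^sup>+z. ennreal (h z) \<partial>count_space UNIV) = 1"
  proof -
    let ?R = "density (count_space UNIV) (\<lambda>z. ennreal (h z))"
    have "emeasure ?R (F n) = ennreal (L b (UNIV \<inter> F n))" for n
      using F_fin[of n] h_nonneg fin_add[OF F_fin, of b n]
      by (simp add: emeasure_density nn_integral_count_space_indicator[symmetric] nn_integral_count_space_finite sum_ennreal h_def)
    then have "(\<lambda>n. emeasure ?R (F n)) \<longlonglongrightarrow> 1"
      using tendsto_ennrealI[OF exhaust[of b UNIV]] by (simp add: total)
    moreover have "(\<lambda>n. emeasure ?R (F n)) \<longlonglongrightarrow> emeasure ?R (\<Union>n. F n)"
      using F_inc by (intro Lim_emeasure_incseq) auto
    ultimately have "emeasure ?R UNIV = 1"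
      by (simp add: F_UN LIMSEQ_unique)
    then show ?thesis by (simp add: emeasure_density)
  qed
  define \<pi> where "\<pi> = embed_pmf h"
  have \<pi>: "pmf \<pi> z = h z" for z
    unfolding \<pi>_def by (rule pmf_embed_pmf) (auto simp: h_nonneg \<open>(\<integral>\<^sup>+z. ennreal (h z) \<partial>count_space UNIV) = 1\<close>)

  \<comment> \<open>Where \<open>h z = 0\<close> the choice of the kernel is immaterial; a point mass keeps it a probability.\<close>
  define \<kappa> where "\<kappa> z = (if h z = 0 then return borel 0 else interval_measure (\<lambda>y. L y {z} / h z))" for z
  have \<kappa>: "real_distribution (\<kappa> z) \<and> h z * measure (\<kappa> z) {..y} = L y {z}" for z y
  proof (cases "h z = 0")
    case True
    have "L y {z} \<le> L (max y b) {z}" by (rule mono) auto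
    then have "L y {z} = 0"
      using True nonneg[of y "{z}"] above[of "max y b" "{z}"] by (simp add: h_def)
    moreover have "real_distribution (return borel (0::real))"
      by (intro real_distribution.intro prob_space_return real_distribution_axioms.intro) auto
    ultimately show ?thesis using True by (simp add: \<kappa>_def)
  next
    case False
    then have pos: "h z > 0" using h_nonneg[of z] by linarith
    let ?G = "\<lambda>y. L y {z} / h z"
    have 1: "?G x \<le> ?G y" if "x \<le> y" for x y using pos mono[OF that order_refl] by (simp add: divide_right_mono)
    have 2: "continuous (at_right x) ?G" for x
      using pos by (intro continuous_divide right_cont continuous_const) auto
    have 3: "(?G \<longlongrightarrow> 0) at_bot"
    proof (rule tendsto_eventually)
      show "\<forall>\<^sub>F y in at_bot. ?G y = 0"
        unfolding eventually_at_bot_dense by (auto simp: below intro!: exI[of _ a])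
    qed
    have 4: "(?G \<longlongrightarrow> 1) at_top"
    proof (rule tendsto_eventually)
      show "\<forall>\<^sub>F y in at_top. ?G y = 1"
        using eventually_ge_at_top[of b]
      proof eventually_elim
        case (elim y)
        then show ?case using above[of y "{z}"] False by (simp add: h_def)
      qed
    qed
    show ?thesis
      using real_distribution_interval_measure[of ?G, OF 1 2 3 4] measure_interval_measure_Iic[of ?G, OF 1 2 3] False
      by (simp add: \<kappa>_def)
  qed
  define N where "N = (borel :: real measure) \<Otimes>\<^sub>M (count_space UNIV :: 'z measure)"
  define k where "k z = distr (\<kappa> z) N (\<lambda>x. (x, z))" for z
  have k_meas: "(\<lambda>x. (x, z)) \<in> \<kappa> z \<rightarrow>\<^sub>M N" for z
  proof -
    interpret real_distribution "\<kappa> z" using \<kappa> by blast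
    have sets: "sets (\<kappa> z) = sets borel" by simp
    have "(\<lambda>x. (x, z)) \<in> borel \<rightarrow>\<^sub>M N"
      unfolding N_def by (intro measurable_Pair) auto
    then show ?thesis by (subst measurable_cong_sets[OF sets refl])
  qed
  have k_prob: "k z \<in> space (prob_algebra N)" for z
  proof -
    interpret real_distribution "\<kappa> z" using \<kappa> by blast
    show ?thesis unfolding k_def space_prob_algebra by (simp add: prob_space_distr[OF k_meas])
  qed
  define Q where "Q = measure_pmf \<pi> \<bind> k"
  have k: "k \<in> measure_pmf \<pi> \<rightarrow>\<^sub>M prob_algebra N"
    using k_prob by (simp add: Pi_def)
  have \<pi>_alg: "measure_pmf \<pi> \<in> space (prob_algebra (measure_pmf \<pi>))"
    by (simp add: space_prob_algebra measure_pmf.prob_space_axioms)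
  have Q_prob: "prob_space Q" unfolding Q_def by (rule prob_space_bind'[OF \<pi>_alg k])
  have Q_sets: "sets Q = sets N" unfolding Q_def by (rule sets_bind'[OF \<pi>_alg k])
  interpret Q: prob_space Q by (rule Q_prob)
  have rect: "{..y} \<times> B \<in> sets N" "UNIV \<times> B \<in> sets N" for y :: real and B :: "'z set"
    unfolding N_def by (intro pair_measureI; simp)+
  have single: "measure Q ({..y} \<times> {z}) = L y {z}" for y z
  proof -
    have "emeasure Q ({..y} \<times> {z}) = (\<integral>\<^sup>+z'. emeasure (k z') ({..y} \<times> {z}) \<partial>measure_pmf \<pi>)"
      unfolding Q_def
      by (rule emeasure_bind[OF _ measurable_prob_algebraD[OF k] rect(1)]) simp
    also have "\<dots> = (\<integral>\<^sup>+z'. emeasure (\<kappa> z) {..y} * indicator {z} z' \<partial>measure_pmf \<pi>)"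
    proof (intro nn_integral_cong)
      fix z'
      interpret real_distribution "\<kappa> z'" using \<kappa> by blast
      have "emeasure (k z') ({..y} \<times> {z}) = emeasure (\<kappa> z') ((\<lambda>x. (x, z')) -` ({..y} \<times> {z}) \<inter> space (\<kappa> z'))"
        unfolding k_def by (rule emeasure_distr[OF k_meas rect(1)])
      also have "(\<lambda>x. (x, z')) -` ({..y} \<times> {z}) \<inter> space (\<kappa> z') = (if z' = z then {..y} else {})"
        by auto
      finally show "emeasure (k z') ({..y} \<times> {z}) = emeasure (\<kappa> z) {..y} * indicator {z} z'" by auto
    qed
    also have "\<dots> = emeasure (\<kappa> z) {..y} * ennreal (h z)"
      by (simp add: nn_integral_cmult emeasure_pmf_single \<pi>)
    also have "\<dots> = ennreal (L y {z})"
    proof -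
      interpret real_distribution "\<kappa> z" using \<kappa> by blast
      show ?thesis using \<kappa>[of z y] h_nonneg[of z]
        by (simp add: emeasure_eq_measure ennreal_mult[symmetric] mult.commute)
    qed
    finally show ?thesis using nonneg[of y "{z}"] by (simp add: measure_def)
  qed
  have fin: "measure Q ({..y} \<times> G) = L y G" if "finite G" for y G
    using that
  proof (induction G)
    case empty
    then show ?case using fin_add[of "{}" y] by simp
  next
    case (insert z G)
    have "{..y} \<times> insert z G = {..y} \<times> {z} \<union> {..y} \<times> G" by auto
    then have "measure Q ({..y} \<times> insert z G) = measure Q ({..y} \<times> {z}) + measure Q ({..y} \<times> G)"
      using insert.hyps rect by (simp only: Q_sets) (intro Q.finite_measure_Union; auto simp: Q_sets)
    then show ?case using insert add[of "{z}" G y] by (simp add: single)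
  qed
  have Q_L: "measure Q ({..y} \<times> B) = L y B" for y B
  proof -
    have "(\<lambda>n. measure Q ({..y} \<times> (B \<inter> F n))) \<longlonglongrightarrow> measure Q (\<Union>n. {..y} \<times> (B \<inter> F n))"
      using F_inc rect by (intro Q.finite_Lim_measure_incseq) (auto simp: Q_sets incseq_def)
    moreover have "(\<Union>n. {..y} \<times> (B \<inter> F n)) = {..y} \<times> B" using F_UN by auto
    moreover have "measure Q ({..y} \<times> (B \<inter> F n)) = L y (B \<inter> F n)" for n
      using F_fin by (intro fin) auto
    ultimately show ?thesis using exhaust[of y B] by (simp add: LIMSEQ_unique)
  qed
  have "measure Q (UNIV \<times> B) = L b B" for B
  proof -
    have "(\<lambda>n. measure Q ({..b + real n} \<times> B)) \<longlonglongrightarrow> measure Q (\<Union>n. {..b + real n} \<times> B)"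
      using rect by (intro Q.finite_Lim_measure_incseq) (auto simp: Q_sets incseq_def)
    moreover have "(\<Union>n. {..b + real n} \<times> B) = UNIV \<times> B"
    proof -
      have "\<exists>n. x \<le> b + real n" for x :: real
        using real_arch_simple[of "x - b"] by (auto simp: algebra_simps)
      then show ?thesis by auto
    qed
    moreover have "measure Q ({..b + real n} \<times> B) = L b B" for n
      unfolding Q_L by (rule above) simp
    ultimately show ?thesis by (simp add: LIMSEQ_const_iff)
  qed
  then show thesis
    using that[of Q] Q_prob Q_sets Q_L by (simp add: N_def)
qed

section \<open>From the chain to its path laws\<close>

lemma markov_chain_prob_space: "markov_chain M K Z \<Longrightarrow> prob_space M"
  and markov_chain_measurable: "markov_chain M K Z \<Longrightarrow> Z t \<in> M \<rightarrow>\<^sub>M count_space UNIV"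
  by (simp_all add: markov_chain_def)

text \<open>The path without its initial state, in the format of \<^const>\<open>chain_path\<close>.\<close>

definition visited :: "(nat \<Rightarrow> 'z) \<Rightarrow> nat \<Rightarrow> 'z list" where
  "visited \<omega> t = map (\<lambda>i. \<omega> (Suc i)) [0..<t]"

lemma visited_Suc: "visited \<omega> (Suc t) = visited \<omega> t @ [\<omega> (Suc t)]"
  by (simp add: visited_def)

lemma length_visited [simp]: "length (visited \<omega> t) = t"
  by (simp add: visited_def)

lemma last_visited: "last (\<omega> 0 # visited \<omega> t) = \<omega> t"
  by (cases t) (simp_all add: visited_def)

lemma aux_process_eq_drive: "aux_process f x t \<omega> = drive f x (\<omega> 0) (visited \<omega> t)"
proof (induction t)
  case (Suc t)
  then show ?case by (simp add: visited_Suc drive_append last_visited del: last.simps)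
qed (simp add: visited_def)

lemma visited_eq_iff:
  assumes "length p = t"
  shows "\<omega> 0 = z \<and> visited \<omega> t = p \<longleftrightarrow> (\<forall>s\<le>t. \<omega> s = (z # p) ! s)"
proof
  assume "\<omega> 0 = z \<and> visited \<omega> t = p"
  then show "\<forall>s\<le>t. \<omega> s = (z # p) ! s"
    by (auto simp: visited_def nth_Cons split: nat.split)
next
  assume *: "\<forall>s\<le>t. \<omega> s = (z # p) ! s"
  have "visited \<omega> t ! i = p ! i" if "i < t" for i
    using *[rule_format, of "Suc i"] that by (simp add: visited_def)
  then show "\<omega> 0 = z \<and> visited \<omega> t = p"
    using *[rule_format, of 0] assms by (auto intro: nth_equalityI)
qed

lemma measurable_visited:
  fixes Z :: "nat \<Rightarrow> 'w \<Rightarrow> 'z::countable"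
  assumes "markov_chain M K Z"
  shows "(\<lambda>\<omega>. (Z 0 \<omega>, visited (\<lambda>s. Z s \<omega>) t)) \<in> M \<rightarrow>\<^sub>M count_space UNIV"
proof -
  have Z: "Z s \<in> M \<rightarrow>\<^sub>M count_space UNIV" for s
    using assms by (rule markov_chain_measurable)
  have visited: "(\<lambda>\<omega>. visited (\<lambda>s. Z s \<omega>) t) \<in> M \<rightarrow>\<^sub>M count_space UNIV" for t
  proof (induction t)
    case (Suc t)
    have "(\<lambda>\<omega>. p @ [Z (Suc t) \<omega>]) \<in> M \<rightarrow>\<^sub>M count_space UNIV" for p
      by (rule measurable_compose[OF Z]) simp
    then show ?case
      unfolding visited_Suc by (rule measurable_compose_countable[OF _ Suc])
  qed (simp add: visited_def)
  have "(\<lambda>\<omega>. (Z 0 \<omega>, p)) \<in> M \<rightarrow>\<^sub>M count_space UNIV" for p :: "'z list"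
    by (rule measurable_compose[OF Z]) simp
  then show ?thesis by (rule measurable_compose_countable[OF _ visited])
qed

text \<open>Induction on the path; the Markov property is only given on events of positive
  probability, so null pasts are treated separately.\<close>

lemma markov_chain_prob_visited:
  fixes Z :: "nat \<Rightarrow> 'w \<Rightarrow> 'z::countable"
  assumes mc: "markov_chain M K Z"
  shows "\<P>(\<omega> in M. Z 0 \<omega> = z \<and> visited (\<lambda>s. Z s \<omega>) t = p) =
    \<P>(\<omega> in M. Z 0 \<omega> = z) * pmf (chain_path K t z) p"
proof (cases "length p = t")
  case False
  then have "p \<notin> set_pmf (chain_path K t z)" by (auto dest: length_path)
  then have "pmf (chain_path K t z) p = 0" by (simp add: set_pmf_iff)
  moreover have "visited (\<lambda>s. Z s \<omega>) t \<noteq> p" for \<omega> using False by auto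
  ultimately show ?thesis by simp
next
  case True
  then show ?thesis
  proof (induction t arbitrary: p)
    case 0
    then show ?case by (simp add: visited_def)
  next
    case (Suc t)
    from Suc.prems obtain q y where p: "p = q @ [y]" "length q = t"
      by (metis append_butlast_last_id diff_Suc_1 length_butlast length_greater_0_conv zero_less_Suc)
    let ?\<zeta> = "\<lambda>s. (z # p) ! s"
    have \<zeta>: "?\<zeta> (Suc t) = y" "?\<zeta> t = last (z # q)"
      using p(2) last_conv_nth[of "z # q"] nth_append_length[of "z # q" y "[]"] nth_append[of "z # q" "[y]" t]
      by (simp_all add: p)
    have past: "(\<forall>s\<le>t. Z s \<omega> = ?\<zeta> s) \<longleftrightarrow> Z 0 \<omega> = z \<and> visited (\<lambda>s. Z s \<omega>) t = q" for \<omega>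
    proof -
      have "?\<zeta> s = (z # q) ! s" if "s \<le> t" for s
        using that p nth_append[of "z # q" "[y]" s] by simp
      then show ?thesis
        using visited_eq_iff[OF p(2), of "\<lambda>s. Z s \<omega>" z] by auto
    qed
    have present: "Z 0 \<omega> = z \<and> visited (\<lambda>s. Z s \<omega>) (Suc t) = p \<longleftrightarrow>
        Z (Suc t) \<omega> = ?\<zeta> (Suc t) \<and> (\<forall>s\<le>t. Z s \<omega> = ?\<zeta> s)" for \<omega>
      unfolding past \<zeta> by (auto simp: visited_Suc p)
    have IH: "\<P>(\<omega> in M. \<forall>s\<le>t. Z s \<omega> = ?\<zeta> s) = \<P>(\<omega> in M. Z 0 \<omega> = z) * pmf (chain_path K t z) q"
      unfolding past by (rule Suc.IH[OF p(2)])
    have step: "\<P>(\<omega> in M. Z (Suc t) \<omega> = ?\<zeta> (Suc t) \<and> (\<forall>s\<le>t. Z s \<omega> = ?\<zeta> s)) =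
        \<P>(\<omega> in M. \<forall>s\<le>t. Z s \<omega> = ?\<zeta> s) * pmf (K (?\<zeta> t)) (?\<zeta> (Suc t))"
    proof (cases "\<P>(\<omega> in M. \<forall>s\<le>t. Z s \<omega> = ?\<zeta> s) = 0")
      case True
      interpret prob_space M using mc by (rule markov_chain_prob_space)
      have "{\<omega> \<in> space M. \<forall>s\<le>t. Z s \<omega> = ?\<zeta> s} \<in> sets M"
        unfolding past using measurable_sets[OF measurable_visited[OF mc, of t], of "{(z, q)}"]
        by (simp add: vimage_def Int_def conj_commute)
      then have "\<P>(\<omega> in M. Z (Suc t) \<omega> = ?\<zeta> (Suc t) \<and> (\<forall>s\<le>t. Z s \<omega> = ?\<zeta> s)) \<le> \<P>(\<omega> in M. \<forall>s\<le>t. Z s \<omega> = ?\<zeta> s)"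
        by (rule finite_measure_mono[rotated]) blast
      then show ?thesis
        unfolding True by (simp only: measure_le_0_iff mult_zero_left)
    next
      case False
      then have pos: "\<P>(\<omega> in M. \<forall>s\<le>t. Z s \<omega> = ?\<zeta> s) > 0"
        by (simp only: zero_less_measure_iff not_False_eq_True)
      have "\<P>(\<omega> in M. Z (Suc t) \<omega> = ?\<zeta> (Suc t) \<bar> \<forall>s\<le>t. Z s \<omega> = ?\<zeta> s) = pmf (K (?\<zeta> t)) (?\<zeta> (Suc t))"
        using mc[unfolded markov_chain_def, THEN conjunct2, THEN conjunct2, rule_format, of t ?\<zeta>, OF pos] .
      moreover have "x = y * k" if "x / y = k" "y \<noteq> 0" for x y k :: real
        using that by auto
      ultimately show ?thesis
        using False unfolding cond_prob_def by blast
    qed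
    have "\<P>(\<omega> in M. Z 0 \<omega> = z \<and> visited (\<lambda>s. Z s \<omega>) (Suc t) = p) =
        \<P>(\<omega> in M. Z 0 \<omega> = z) * pmf (chain_path K t z) q * pmf (K (?\<zeta> t)) (?\<zeta> (Suc t))"
      unfolding present step IH ..
    also have "\<dots> = \<P>(\<omega> in M. Z 0 \<omega> = z) * pmf (chain_path K (Suc t) z) p"
      unfolding \<zeta> by (simp add: p pmf_path_snoc del: last.simps)
    finally show ?case .
  qed
qed

text \<open>Reduces events about a realisation of the chain, on an arbitrary probability space, to the
  discrete path laws.\<close>

lemma markov_chain_path_law:
  fixes Z :: "nat \<Rightarrow> 'w \<Rightarrow> 'z::countable"
  assumes mc: "markov_chain M K Z"
  obtains \<nu> :: "'z pmf" where "\<And>z. pmf \<nu> z = \<P>(\<omega> in M. Z 0 \<omega> = z)"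
    and "\<And>t E. \<P>(\<omega> in M. E (Z 0 \<omega>) (visited (\<lambda>s. Z s \<omega>) t)) =
      (\<integral>z. measure (chain_path K t z) {p. E z p} \<partial>\<nu>)"
proof -
  interpret prob_space M using mc by (rule markov_chain_prob_space)
  have Z0: "Z 0 \<in> M \<rightarrow>\<^sub>M count_space UNIV" using mc by (rule markov_chain_measurable)
  have Z0_eq: "emeasure (distr M (count_space UNIV) (Z 0)) {z} = ennreal (\<P>(\<omega> in M. Z 0 \<omega> = z))" for z
    using Z0 by (simp add: emeasure_distr emeasure_eq_measure vimage_def Int_def conj_commute)
  define \<nu> where "\<nu> = embed_pmf (\<lambda>z. \<P>(\<omega> in M. Z 0 \<omega> = z))"
  have \<nu>: "pmf \<nu> z = \<P>(\<omega> in M. Z 0 \<omega> = z)" for z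
    unfolding \<nu>_def
  proof (rule pmf_embed_pmf)
    have "(\<integral>\<^sup>+z. ennreal (\<P>(\<omega> in M. Z 0 \<omega> = z)) \<partial>count_space UNIV) = emeasure (distr M (count_space UNIV) (Z 0)) UNIV"
      by (subst emeasure_countable_singleton) (auto simp: Z0_eq)
    also have "\<dots> = 1"
      using prob_space.emeasure_space_1[OF prob_space_distr[OF Z0]] by simp
    finally show "(\<integral>\<^sup>+z. ennreal (\<P>(\<omega> in M. Z 0 \<omega> = z)) \<partial>count_space UNIV) = 1" .
  qed simp
  have law: "distr M (count_space UNIV) (\<lambda>\<omega>. (Z 0 \<omega>, visited (\<lambda>s. Z s \<omega>) t)) =
      measure_pmf (bind_pmf \<nu> (\<lambda>z. map_pmf (Pair z) (chain_path K t z)))" (is "?D = measure_pmf ?P") for t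
  proof (rule measure_eqI_countable[of _ UNIV])
    fix w :: "'z \<times> 'z list"
    obtain z p where w: "w = (z, p)" by (cases w)
    have eq: "pmf (map_pmf (Pair z') (chain_path K t z')) (z, p) = indicator {z} z' * pmf (chain_path K t z) p" for z'
    proof (cases "z' = z")
      case True
      then show ?thesis by (simp add: pmf_map_inj'[of "Pair z"] inj_on_def)
    next
      case False
      then show ?thesis by (simp add: pmf_map_outside image_def)
    qed
    have "emeasure ?D {w} = ennreal (\<P>(\<omega> in M. Z 0 \<omega> = z \<and> visited (\<lambda>s. Z s \<omega>) t = p))"
      using measurable_visited[OF mc, of t]
      by (simp add: w emeasure_distr emeasure_eq_measure vimage_def Int_def conj_commute)
    also have "\<dots> = ennreal (pmf ?P (z, p))"
      by (simp add: markov_chain_prob_visited[OF mc] pmf_bind eq measure_pmf_single \<nu>)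
    finally show "emeasure ?D {w} = emeasure ?P {w}"
      by (simp only: emeasure_pmf_single w)
  qed auto
  have "\<P>(\<omega> in M. E (Z 0 \<omega>) (visited (\<lambda>s. Z s \<omega>) t)) = (\<integral>z. measure (chain_path K t z) {p. E z p} \<partial>\<nu>)" for t E
  proof -
    have "\<P>(\<omega> in M. E (Z 0 \<omega>) (visited (\<lambda>s. Z s \<omega>) t)) =
        measure (distr M (count_space UNIV) (\<lambda>\<omega>. (Z 0 \<omega>, visited (\<lambda>s. Z s \<omega>) t))) {(z, p). E z p}"
      using measurable_visited[OF mc, of t] by (simp add: measure_distr vimage_def Int_def conj_commute)
    also have "\<dots> = (\<integral>z. measure (chain_path K t z) {p. E z p} \<partial>\<nu>)"
      unfolding law measure_bind_pmf by (simp add: vimage_def)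
    finally show ?thesis .
  qed
  with \<nu> show thesis by (rule that)
qed

lemma chain_law_visited:
  fixes K :: "'z::countable \<Rightarrow> 'z pmf"
  shows "\<P>(\<omega> in chain_law K z. E (\<omega> 0) (visited \<omega> t)) = measure (chain_path K t z) {p. E z p}"
proof -
  obtain \<nu> where \<nu>: "\<And>y. pmf \<nu> y = \<P>(\<omega> in chain_law K z. \<omega> 0 = y)"
    and law: "\<And>t E. \<P>(\<omega> in chain_law K z. E (\<omega> 0) (visited \<omega> t)) =
      (\<integral>y. measure (chain_path K t y) {p. E y p} \<partial>\<nu>)"
    using markov_chain_path_law[OF markov_chain_chain_law[of K z]] by auto
  have "pmf \<nu> z = 1" using chain_law_start[of K z] by (simp add: \<nu>)
  then have "AE y in \<nu>. y = z"
    using measure_pmf.AE_prob_1[of \<nu> "{z}"] by (simp add: measure_pmf_single)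
  then have "(\<integral>y. measure (chain_path K t y) {p. E y p} \<partial>\<nu>) = (\<integral>y. measure (chain_path K t z) {p. E z p} \<partial>\<nu>)"
    by (intro integral_cong_AE) auto
  then show ?thesis by (simp only: law) simp
qed

lemma measurable_chain_law_visited: "{\<omega>. E (visited \<omega> t)} \<in> sets (chain_law K z)"
  for K :: "'z::countable \<Rightarrow> 'z pmf"
  using measurable_sets[OF measurable_visited[OF markov_chain_chain_law[of K z], of t], of "UNIV \<times> {p. E p}"]
  by (simp add: vimage_def)

section \<open>The hitting time\<close>

lemma less_hitting_time_iff: "enat t < hitting_time z0 \<omega> \<longleftrightarrow> z0 \<notin> set (visited \<omega> t)"
proof -
  have "enat t < hitting_time z0 \<omega> \<longleftrightarrow> enat (Suc t) \<le> hitting_time z0 \<omega>"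
    by (simp add: Suc_ile_eq)
  also have "\<dots> \<longleftrightarrow> (\<forall>s. 1 \<le> s \<and> \<omega> s = z0 \<longrightarrow> t < s)"
    unfolding hitting_time_def by (auto simp: le_INF_iff)
  also have "\<dots> \<longleftrightarrow> z0 \<notin> set (visited \<omega> t)"
  proof
    assume *: "\<forall>s. 1 \<le> s \<and> \<omega> s = z0 \<longrightarrow> t < s"
    have "\<omega> (Suc i) \<noteq> z0" if "i < t" for i
      using *[rule_format, of "Suc i"] that by auto
    then show "z0 \<notin> set (visited \<omega> t)" unfolding visited_def by auto blast
  next
    assume *: "z0 \<notin> set (visited \<omega> t)"
    show "\<forall>s. 1 \<le> s \<and> \<omega> s = z0 \<longrightarrow> t < s"
    proof (intro allI impI)
      fix s assume s: "1 \<le> s \<and> \<omega> s = z0"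
      then obtain i where "s = Suc i" by (cases s) auto
      then show "t < s" using * s by (fastforce simp: visited_def image_iff not_less)
    qed
  qed
  finally show ?thesis .
qed

lemma prob_less_hitting_time:
  fixes K :: "'z::countable \<Rightarrow> 'z pmf"
  shows "measure (chain_law K z) {\<omega>. enat t < hitting_time z0 \<omega>} = avoid K z0 t z"
  using chain_law_visited[of K z "\<lambda>_ p. z0 \<notin> set p" t] by (simp add: less_hitting_time_iff avoid_def)

lemma sets_less_hitting_time:
  fixes K :: "'z::countable \<Rightarrow> 'z pmf"
  shows "{\<omega>. enat t < hitting_time z0 \<omega>} \<in> sets (chain_law K z)"
  unfolding less_hitting_time_iff by (rule measurable_chain_law_visited)

lemma avoid_tendsto_0:
  fixes K :: "'z::countable \<Rightarrow> 'z pmf"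
  assumes "positive_recurrent_atom K z0"
  shows "(\<lambda>t. avoid K z0 t z) \<longlonglongrightarrow> 0"
proof -
  interpret prob_space "chain_law K z" by (rule prob_space_chain_law)
  let ?A = "\<lambda>t. {\<omega>. enat t < hitting_time z0 \<omega>}"
  have "(\<lambda>t. measure (chain_law K z) (?A t)) \<longlonglongrightarrow> measure (chain_law K z) (\<Inter>t. ?A t)"
  proof (intro finite_Lim_measure_decseq)
    show "decseq ?A"
      unfolding decseq_def using le_less_trans[of "enat m" "enat n" for m n] by auto
  qed (use sets_less_hitting_time[of _ z0 K z] in auto)
  moreover have "AE \<omega> in chain_law K z. \<omega> \<notin> (\<Inter>t. ?A t)"
    using assms[unfolded positive_recurrent_atom_def, THEN conjunct1, rule_format, of z]
    by (rule AE_mp) (auto intro!: AE_I2)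
  then have "measure (chain_law K z) (\<Inter>t. ?A t) = 0"
    using sets_less_hitting_time[of _ z0 K z] by (subst prob_eq_0) auto
  ultimately show ?thesis by (simp add: prob_less_hitting_time)
qed

lemma summable_avoid:
  fixes K :: "'z::countable \<Rightarrow> 'z pmf"
  assumes "positive_recurrent_atom K z0"
  shows "summable (\<lambda>t. avoid K z0 t z0)"
proof (rule summable_suminf_not_top)
  interpret prob_space "chain_law K z0" by (rule prob_space_chain_law)
  let ?A = "\<lambda>t. {\<omega>. enat t < hitting_time z0 \<omega>}"
  have "(\<Sum>t. ennreal (avoid K z0 t z0)) = (\<Sum>t. \<integral>\<^sup>+\<omega>. indicator (?A t) \<omega> \<partial>chain_law K z0)"
    using sets_less_hitting_time[of _ z0 K z0] by (simp add: emeasure_eq_measure prob_less_hitting_time)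
  also have "\<dots> = (\<integral>\<^sup>+\<omega>. (\<Sum>t. indicator (?A t) \<omega>) \<partial>chain_law K z0)"
    using sets_less_hitting_time[of _ z0 K z0] by (intro nn_integral_suminf[symmetric]) auto
  also have "\<dots> \<le> (\<integral>\<^sup>+\<omega>. ennreal_of_enat (hitting_time z0 \<omega>) \<partial>chain_law K z0)"
  proof (intro nn_integral_mono)
    fix \<omega>
    show "(\<Sum>t. indicator (?A t) \<omega>) \<le> ennreal_of_enat (hitting_time z0 \<omega>)"
    proof (cases "hitting_time z0 \<omega>")
      case (enat n)
      then have "(\<Sum>t. indicator (?A t) \<omega> :: ennreal) = (\<Sum>t<n. 1)"
        by (subst suminf_finite[of "{..<n}"]) auto
      then show ?thesis by (simp add: enat)
    qed simp
  qed
  also have "\<dots> < \<infinity>" using assms by (simp add: positive_recurrent_atom_def)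
  finally show "(\<Sum>t. ennreal (avoid K z0 t z0)) \<noteq> top" by simp
qed (rule avoid_nonneg)

lemma Gcd_avoid:
  fixes K :: "'z::countable \<Rightarrow> 'z pmf"
  assumes "aperiodic_at K z0"
  shows "Gcd {Suc s |s. avoid K z0 (Suc s) z0 < avoid K z0 s z0} = 1"
proof -
  interpret prob_space "chain_law K z0" by (rule prob_space_chain_law)
  let ?A = "\<lambda>t. {\<omega>. enat t < hitting_time z0 \<omega>}"
  have zero: "{\<omega>. hitting_time z0 \<omega> = enat 0} = {}"
  proof -
    have "hitting_time z0 \<omega> \<noteq> enat 0" for \<omega> :: "nat \<Rightarrow> 'z"
      using less_hitting_time_iff[of 0 z0 \<omega>] by (auto simp: visited_def)
    then show ?thesis by blast
  qed
  have Suc: "measure (chain_law K z0) {\<omega>. hitting_time z0 \<omega> = enat (Suc s)} = avoid K z0 s z0 - avoid K z0 (Suc s) z0" for s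
  proof -
    have "{\<omega>. hitting_time z0 \<omega> = enat (Suc s)} = ?A s - ?A (Suc s)"
      by (auto simp: not_less Suc_ile_eq order.antisym)
    then show ?thesis
      using sets_less_hitting_time[of _ z0 K z0]
      by (simp add: prob_less_hitting_time[symmetric])
        (subst finite_measure_Diff; use le_less_trans[of "enat s" "enat (Suc s)"] in auto)
  qed
  have "{n::nat. \<P>(\<omega> in chain_law K z0. hitting_time z0 \<omega> = enat n) > 0} =
      {Suc s |s. avoid K z0 (Suc s) z0 < avoid K z0 s z0}" (is "?L = ?R")
  proof (intro set_eqI)
    fix n show "n \<in> ?L \<longleftrightarrow> n \<in> ?R"
      using zero by (cases n) (simp_all add: Suc)
  qed
  then show ?thesis using assms by (simp add: aperiodic_at_def)
qed

section \<open>Convergence of the recursion\<close>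

lemma uniform_dist_tendsto_0_iff:
  assumes "\<And>t. real_distribution (\<mu> t)" "real_distribution \<nu>"
  shows "(\<lambda>t. uniform_dist (\<mu> t) \<nu>) \<longlonglongrightarrow> 0 \<longleftrightarrow> 
    (\<exists>\<kappa>. \<kappa> \<longlonglongrightarrow> 0 \<and> (\<forall>t x. \<bar>cdf (\<mu> t) x - cdf \<nu> x\<bar> \<le> \<kappa> t))"
proof -
  have "\<bar>cdf (\<mu> t) x - cdf \<nu> x\<bar> \<le> 1" for t x
    using real_distribution.cdf_bounded_prob[OF assms(1)[of t], of x] real_distribution.cdf_bounded_prob[OF assms(2), of x]
      finite_borel_measure.cdf_nonneg[of "\<mu> t" x] finite_borel_measure.cdf_nonneg[of \<nu> x]
      real_distribution.finite_borel_measure_M[OF assms(1)[of t]] real_distribution.finite_borel_measure_M[OF assms(2)]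
    by (auto simp: abs_le_iff)
  then have "bdd_above (range (\<lambda>x. \<bar>cdf (\<mu> t) x - cdf \<nu> x\<bar>))" for t by (auto intro!: bdd_aboveI2)
  then have upper: "\<bar>cdf (\<mu> t) x - cdf \<nu> x\<bar> \<le> uniform_dist (\<mu> t) \<nu>" for t x
    unfolding uniform_dist_def by (intro cSUP_upper) auto
  show ?thesis
  proof
    assume "(\<lambda>t. uniform_dist (\<mu> t) \<nu>) \<longlonglongrightarrow> 0"
    then show "\<exists>\<kappa>. \<kappa> \<longlonglongrightarrow> 0 \<and> (\<forall>t x. \<bar>cdf (\<mu> t) x - cdf \<nu> x\<bar> \<le> \<kappa> t)"
      using upper by blast
  next
    assume "\<exists>\<kappa>. \<kappa> \<longlonglongrightarrow> 0 \<and> (\<forall>t x. \<bar>cdf (\<mu> t) x - cdf \<nu> x\<bar> \<le> \<kappa> t)"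
    then obtain \<kappa> where \<kappa>: "\<kappa> \<longlonglongrightarrow> 0" "\<And>t x. \<bar>cdf (\<mu> t) x - cdf \<nu> x\<bar> \<le> \<kappa> t" by blast
    show "(\<lambda>t. uniform_dist (\<mu> t) \<nu>) \<longlonglongrightarrow> 0"
    proof (rule tendsto_sandwich[OF _ _ tendsto_const \<kappa>(1)])
      show "\<forall>\<^sub>F t in sequentially. 0 \<le> uniform_dist (\<mu> t) \<nu>"
        using upper by (intro always_eventually allI order_trans[OF abs_ge_zero upper])
      show "\<forall>\<^sub>F t in sequentially. uniform_dist (\<mu> t) \<nu> \<le> \<kappa> t"
        unfolding uniform_dist_def by (intro always_eventually allI cSUP_least \<kappa>(2)) simp
    qed
  qed
qed

lemma uniform_dist_limit_unique:
  assumes "\<And>t. real_distribution (\<mu> t)" "real_distribution \<nu>" "real_distribution \<nu>'"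
    and "(\<lambda>t. uniform_dist (\<mu> t) \<nu>) \<longlonglongrightarrow> 0" "(\<lambda>t. uniform_dist (\<mu> t) \<nu>') \<longlonglongrightarrow> 0"
  shows "\<nu> = \<nu>'"
proof (rule cdf_unique[OF assms(2,3)], rule ext)
  fix x
  have lim: "(\<lambda>t. cdf (\<mu> t) x) \<longlonglongrightarrow> cdf \<nu> x" if \<nu>: "real_distribution \<nu>" "(\<lambda>t. uniform_dist (\<mu> t) \<nu>) \<longlonglongrightarrow> 0" for \<nu>
  proof -
    obtain \<kappa> where "\<kappa> \<longlonglongrightarrow> 0 \<and> (\<forall>t x. \<bar>cdf (\<mu> t) x - cdf \<nu> x\<bar> \<le> \<kappa> t)"
      using iffD1[OF uniform_dist_tendsto_0_iff[of \<mu> \<nu>, OF assms(1) \<nu>(1)] \<nu>(2)] by (elim exE)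
    then have \<kappa>: "\<kappa> \<longlonglongrightarrow> 0" "\<bar>cdf (\<mu> t) x - cdf \<nu> x\<bar> \<le> \<kappa> t" for t
      by auto
    have "(\<lambda>t. cdf (\<mu> t) x - cdf \<nu> x) \<longlonglongrightarrow> 0"
      by (rule Lim_null_comparison[OF _ \<kappa>(1)]) (simp add: \<kappa>(2))
    then show ?thesis by (simp add: LIM_zero_iff)
  qed
  show "cdf \<nu> x = cdf \<nu>' x"
    using lim[OF assms(2,4)] lim[OF assms(3,5)] by (rule LIMSEQ_unique)
qed

context ergodic_recursion
begin

lemma lower_atMost: "lower {..y}"
  by (auto simp: lower_def)

text \<open>The trajectory is squeezed pathwise between those started at \<open>a\<close> and at \<open>b\<close>, however \<open>X\<^sub>0\<close> and the
  chain are coupled, and both have the same limit.\<close>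

theorem recursion_converges:
  fixes Z :: "nat \<Rightarrow> 'w \<Rightarrow> 'z" and X :: "nat \<Rightarrow> 'w \<Rightarrow> real"
  assumes mc: "markov_chain M K Z"
    and X_meas: "\<And>t. X t \<in> borel_measurable M"
    and X0: "\<And>\<omega>. \<omega> \<in> space M \<Longrightarrow> X 0 \<omega> \<in> {a..b}"
    and X_Suc: "\<And>t \<omega>. \<omega> \<in> space M \<Longrightarrow> X (Suc t) \<omega> = f (X t \<omega>) (Z t \<omega>)"
  obtains \<kappa> where "\<kappa> \<longlonglongrightarrow> 0"
    and "\<And>t y B. \<bar>\<P>(\<omega> in M. X t \<omega> \<le> y \<and> Z t \<omega> \<in> B) - limit {..y} B\<bar> \<le> \<kappa> t"
proof -
  interpret prob_space M using mc by (rule markov_chain_prob_space)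
  obtain \<nu> :: "'z pmf" where "\<And>z. pmf \<nu> z = \<P>(\<omega> in M. Z 0 \<omega> = z)"
    and law: "\<And>t E. \<P>(\<omega> in M. E (Z 0 \<omega>) (visited (\<lambda>s. Z s \<omega>) t)) =
      (\<integral>z. measure (chain_path K t z) {p. E z p} \<partial>\<nu>)"
    using markov_chain_path_law[OF mc] by blast
  obtain \<kappa> where \<kappa>: "\<kappa> \<longlonglongrightarrow> 0"
    and unif: "\<And>t x I B. lower I \<Longrightarrow> x \<in> {a..b} \<Longrightarrow> \<bar>(\<integral>z. joint t x z I B \<partial>\<nu>) - limit I B\<bar> \<le> \<kappa> t"
    using uniform_limit_from_law[of \<nu>] by blast
  let ?Y = "\<lambda>x t \<omega>. drive f x (Z 0 \<omega>) (visited (\<lambda>s. Z s \<omega>) t)"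
  have Y_Suc: "?Y x (Suc t) \<omega> = f (?Y x t \<omega>) (Z t \<omega>)" for x t \<omega>
    using aux_process_eq_drive[of f x "Suc t" "\<lambda>s. Z s \<omega>"] aux_process_eq_drive[of f x t "\<lambda>s. Z s \<omega>"] by simp
  have between: "X t \<omega> \<in> {a..b} \<and> ?Y a t \<omega> \<le> X t \<omega> \<and> X t \<omega> \<le> ?Y b t \<omega>" if \<omega>: "\<omega> \<in> space M" for t \<omega>
  proof (induction t)
    case 0
    then show ?case using X0[OF \<omega>] by (simp add: visited_def)
  next
    case (Suc t)
    then show ?case
      unfolding Y_Suc X_Suc[OF \<omega>] using drive_in[OF a_in] drive_in[OF b_in] f_in f_mono by blast
  qed
  have ends: "\<P>(\<omega> in M. ?Y x t \<omega> \<in> {..y} \<and> Z t \<omega> \<in> B) = (\<integral>z. joint t x z {..y} B \<partial>\<nu>)" for x t y B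
    using law[of "\<lambda>z p. drive f x z p \<in> {..y} \<and> last (z # p) \<in> B" t]
    by (simp only: last_visited[of "\<lambda>s. Z s _"] joint_def)
  have sets: "{\<omega> \<in> space M. ?Y x t \<omega> \<in> {..y} \<and> Z t \<omega> \<in> B} \<in> events" for x t y B
    using measurable_sets[OF measurable_visited[OF mc, of t], of "{(z, p). drive f x z p \<in> {..y} \<and> last (z # p) \<in> B}"]
    by (simp add: vimage_def Int_def conj_commute last_visited[of "\<lambda>s. Z s _"] del: last.simps)
  have Z_sets: "{\<omega> \<in> space M. Z t \<omega> \<in> B} \<in> events" for t B
    using measurable_sets[OF markov_chain_measurable[OF mc, of t], of B] by (simp add: vimage_def Int_def conj_commute)
  have X_sets: "{\<omega> \<in> space M. X t \<omega> \<le> y \<and> Z t \<omega> \<in> B} \<in> events" for t y B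
    using X_meas[of t] Z_sets[of t B] by (intro sets.sets_Collect_conj) auto
  show thesis
  proof (rule that[OF \<kappa>])
    fix t y B
    have "\<P>(\<omega> in M. X t \<omega> \<le> y \<and> Z t \<omega> \<in> B) \<le> \<P>(\<omega> in M. ?Y a t \<omega> \<in> {..y} \<and> Z t \<omega> \<in> B)"
      using between sets by (intro finite_measure_mono) (auto intro: order_trans)
    moreover have "\<P>(\<omega> in M. ?Y b t \<omega> \<in> {..y} \<and> Z t \<omega> \<in> B) \<le> \<P>(\<omega> in M. X t \<omega> \<le> y \<and> Z t \<omega> \<in> B)"
      using between X_sets by (intro finite_measure_mono) (auto intro: order_trans)
    ultimately show "\<bar>\<P>(\<omega> in M. X t \<omega> \<le> y \<and> Z t \<omega> \<in> B) - limit {..y} B\<bar> \<le> \<kappa> t"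
      using unif[OF lower_atMost a_in, of t y B] unif[OF lower_atMost b_in, of t y B] unfolding ends by linarith
  qed
qed

lemma recursion_distribution_converges:
  fixes Z :: "nat \<Rightarrow> 'w \<Rightarrow> 'z" and X :: "nat \<Rightarrow> 'w \<Rightarrow> real"
  assumes mc: "markov_chain M K Z"
    and X_meas: "\<And>t. X t \<in> borel_measurable M"
    and X0: "\<And>\<omega>. \<omega> \<in> space M \<Longrightarrow> X 0 \<omega> \<in> {a..b}"
    and X_Suc: "\<And>t \<omega>. \<omega> \<in> space M \<Longrightarrow> X (Suc t) \<omega> = f (X t \<omega>) (Z t \<omega>)"
    and \<mu>: "real_distribution \<mu>" and cdf_\<mu>: "\<And>y. cdf \<mu> y = limit {..y} UNIV"
  shows "real_distribution (distr M borel (X t))"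
    and "(\<lambda>t. uniform_dist (distr M borel (X t)) \<mu>) \<longlonglongrightarrow> 0"
proof -
  interpret prob_space M using mc by (rule markov_chain_prob_space)
  show dist: "real_distribution (distr M borel (X t))" for t
    by (intro real_distribution.intro prob_space_distr X_meas real_distribution_axioms.intro) auto
  obtain \<kappa> where \<kappa>: "\<kappa> \<longlonglongrightarrow> 0"
    and bound: "\<And>t y B. \<bar>\<P>(\<omega> in M. X t \<omega> \<le> y \<and> Z t \<omega> \<in> B) - limit {..y} B\<bar> \<le> \<kappa> t"
    using recursion_converges[of M Z X, OF mc X_meas X0 X_Suc] by blast
  have "cdf (distr M borel (X t)) y = \<P>(\<omega> in M. X t \<omega> \<le> y \<and> Z t \<omega> \<in> UNIV)" for t y
    unfolding cdf_def using X_meas[of t] by (simp add: measure_distr vimage_def Int_def conj_commute)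
  then have "\<bar>cdf (distr M borel (X t)) y - cdf \<mu> y\<bar> \<le> \<kappa> t" for t y
    using bound[of t y UNIV] by (simp only: cdf_\<mu>)
  then show "(\<lambda>t. uniform_dist (distr M borel (X t)) \<mu>) \<longlonglongrightarrow> 0"
    using \<kappa> by (subst uniform_dist_tendsto_0_iff[OF dist \<mu>]) blast
qed

theorem limit_law_exists:
  obtains Q where "prob_space Q" and "sets Q = sets (borel \<Otimes>\<^sub>M count_space UNIV)"
    and "\<And>y B. measure Q ({..y} \<times> B) = limit {..y} B" and "\<And>B. measure Q (UNIV \<times> B) = limit {..b} B"
proof -
  obtain \<theta> where \<theta>: "\<theta> \<longlonglongrightarrow> 0" and "\<And>t. 0 \<le> \<theta> t"
    and unif: "\<And>t x I B. lower I \<Longrightarrow> x \<in> {a..b} \<Longrightarrow> \<bar>joint t x z0 I B - limit I B\<bar> \<le> \<theta> t"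
    using uniform_limit_from_atom by blast
  let ?P = "\<lambda>t. map_pmf (\<lambda>p. (drive f a z0 p, last (z0 # p))) (chain_path K t z0)"
  have joint: "measure (?P t) ({..y} \<times> B) = joint t a z0 {..y} B" for t y B
    by (simp add: joint_def vimage_def del: last.simps)
  show thesis
  proof (rule uniform_limit_of_laws[of ?P a b \<theta> "\<lambda>y B. limit {..y} B"])
    show "set_pmf (?P t) \<subseteq> {a..b} \<times> UNIV" for t
      using drive_in[OF a_in] by auto
    show "\<bar>measure (?P t) ({..y} \<times> B) - limit {..y} B\<bar> \<le> \<theta> t" for t y B
      unfolding joint by (rule unif[OF lower_atMost a_in])
  qed (use \<theta> that in auto)
qed

end

section \<open>Realising the hypotheses and the limit\<close>

lemma recursion_measurable:
  fixes f :: "real \<Rightarrow> 'z::countable \<Rightarrow> real"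
  assumes f: "case_prod f \<in> restrict_space borel {a..b} \<Otimes>\<^sub>M count_space UNIV \<rightarrow>\<^sub>M restrict_space borel {a..b}"
    and Z: "\<And>t. Z t \<in> M \<rightarrow>\<^sub>M count_space UNIV"
    and X0: "X 0 \<in> borel_measurable M" "\<And>\<omega>. \<omega> \<in> space M \<Longrightarrow> X 0 \<omega> \<in> {a..b}"
    and X_Suc: "\<And>t \<omega>. \<omega> \<in> space M \<Longrightarrow> X (Suc t) \<omega> = f (X t \<omega>) (Z t \<omega>)"
  shows "X t \<in> borel_measurable M"
proof -
  have "X t \<in> M \<rightarrow>\<^sub>M restrict_space borel {a..b}"
  proof (induction t)
    case 0
    then show ?case using X0 by (intro measurable_restrict_space2) auto
  next
    case (Suc t)
    have "(\<lambda>\<omega>. case_prod f (X t \<omega>, Z t \<omega>)) \<in> M \<rightarrow>\<^sub>M restrict_space borel {a..b}"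
      by (rule measurable_compose[OF measurable_Pair[OF Suc Z] f])
    then show ?case by (subst measurable_cong[OF X_Suc]) simp_all
  qed
  then show ?thesis by (simp add: measurable_restrict_space2_iff)
qed

text \<open>Repeating a single draw is the simplest way of giving a stationary sequence a prescribed
  one-time law, and the approximation in the theorem compares laws at one time.\<close>

lemma constant_sequence_stationary:
  fixes Q :: "'a measure"
  assumes "prob_space Q" "sets Q = sets N" "g \<in> N \<rightarrow>\<^sub>M N'"
  shows "stationary_sequence (distr Q (Pi\<^sub>M UNIV (\<lambda>_::nat. N)) (\<lambda>q _. q)) N' (\<lambda>t s. g (s 0))"
    and "A \<in> sets N \<Longrightarrow> measure (distr Q (Pi\<^sub>M UNIV (\<lambda>_::nat. N)) (\<lambda>q _. q))
      {s \<in> space (Pi\<^sub>M UNIV (\<lambda>_::nat. N)). s 0 \<in> A} = measure Q A"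
proof -
  have id: "(\<lambda>q. q) \<in> Q \<rightarrow>\<^sub>M N" using assms(2) by (simp add: measurable_ident_sets)
  have const: "(\<lambda>q _. q) \<in> Q \<rightarrow>\<^sub>M Pi\<^sub>M UNIV (\<lambda>_::nat. N)"
    using sets_eq_imp_space_eq[OF assms(2)] by (intro measurable_PiM_single' id) (auto simp: PiE_def)
  have "(\<lambda>s. g (s 0)) \<in> Pi\<^sub>M UNIV (\<lambda>_::nat. N) \<rightarrow>\<^sub>M N'"
    by (rule measurable_compose[OF measurable_component_singleton[of 0 UNIV "\<lambda>_. N"] assms(3)]) simp
  then show "stationary_sequence (distr Q (Pi\<^sub>M UNIV (\<lambda>_::nat. N)) (\<lambda>q _. q)) N' (\<lambda>t s. g (s 0))"
    unfolding stationary_sequence_def using prob_space.prob_space_distr[OF assms(1) const] by simp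
  assume A: "A \<in> sets N"
  have "{s \<in> space (Pi\<^sub>M UNIV (\<lambda>_::nat. N)). s 0 \<in> A} \<in> sets (Pi\<^sub>M UNIV (\<lambda>_::nat. N))"
    using measurable_sets[OF measurable_component_singleton[of 0 UNIV "\<lambda>_. N"] A]
    by (simp add: vimage_def Int_def conj_commute)
  moreover have "(\<lambda>q _. q) -` {s \<in> space (Pi\<^sub>M UNIV (\<lambda>_::nat. N)). s 0 \<in> A} \<inter> space Q = A"
    using sets.sets_into_space[OF A] sets_eq_imp_space_eq[OF assms(2)] by (auto simp: space_PiM PiE_def)
  ultimately show "measure (distr Q (Pi\<^sub>M UNIV (\<lambda>_::nat. N)) (\<lambda>q _. q))
      {s \<in> space (Pi\<^sub>M UNIV (\<lambda>_::nat. N)). s 0 \<in> A} = measure Q A"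
    by (simp add: measure_distr[OF const])
qed

lemma SUP_SUP_tendsto_0:
  fixes h :: "nat \<Rightarrow> 'a \<Rightarrow> 'b \<Rightarrow> real"
  assumes "A \<noteq> {}" "\<kappa> \<longlonglongrightarrow> 0" and bound: "\<And>t x B. x \<in> A \<Longrightarrow> \<bar>h t x B\<bar> \<le> \<kappa> t"
  shows "(\<lambda>t. SUP x\<in>A. SUP B. \<bar>h t x B\<bar>) \<longlonglongrightarrow> 0"
proof (rule tendsto_sandwich[OF _ _ tendsto_const assms(2)])
  have inner: "(SUP B. \<bar>h t x B\<bar>) \<le> \<kappa> t" "0 \<le> (SUP B. \<bar>h t x B\<bar>)" if "x \<in> A" for t x
  proof -
    show "(SUP B. \<bar>h t x B\<bar>) \<le> \<kappa> t" by (rule cSUP_least) (simp_all add: bound that)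
    have "\<bar>h t x undefined\<bar> \<le> (SUP B. \<bar>h t x B\<bar>)"
      by (rule cSUP_upper) (auto intro!: bdd_aboveI2 bound that)
    then show "0 \<le> (SUP B. \<bar>h t x B\<bar>)" by linarith
  qed
  show "\<forall>\<^sub>F t in sequentially. (SUP x\<in>A. SUP B. \<bar>h t x B\<bar>) \<le> \<kappa> t"
    by (intro always_eventually allI cSUP_least inner) (use assms in auto)
  obtain x where x: "x \<in> A" using assms(1) by blast
  have "0 \<le> (SUP x\<in>A. SUP B. \<bar>h t x B\<bar>)" for t
    by (rule order_trans[OF inner(2)[OF x, of t]], rule cSUP_upper[OF x]) (auto intro!: bdd_aboveI2 inner)
  then show "\<forall>\<^sub>F t in sequentially. 0 \<le> (SUP x\<in>A. SUP B. \<bar>h t x B\<bar>)" by simp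
qed

lemma chain_law_word:
  fixes K :: "'z::countable \<Rightarrow> 'z pmf"
  assumes "\<P>(\<omega> in chain_law K z. \<forall>j\<in>{1..n}. \<omega> j = w j \<bar> \<omega> 0 = z) > 0"
  shows "map (\<lambda>i. w (Suc i)) [0..<n] \<in> set_pmf (chain_path K n z)"
proof -
  let ?q = "map (\<lambda>i. w (Suc i)) [0..<n]"
  have eq: "visited \<omega> n = ?q \<longleftrightarrow> (\<forall>j\<in>{1..n}. \<omega> j = w j)" for \<omega>
  proof
    assume "visited \<omega> n = ?q"
    then have "\<omega> (Suc i) = w (Suc i)" if "i < n" for i
      using that by (simp add: visited_def)
    then show "\<forall>j\<in>{1..n}. \<omega> j = w j"
      by (metis Suc_le_D Suc_le_lessD atLeastAtMost_iff One_nat_def le_simps(2))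
  qed (auto simp: visited_def)
  have "0 < \<P>(\<omega> in chain_law K z. (\<forall>j\<in>{1..n}. \<omega> j = w j) \<and> \<omega> 0 = z)"
    using assms by (simp add: cond_prob_def zero_less_divide_iff chain_law_start[unfolded space_chain_law])
  then have "0 < measure (chain_path K n z) {p. p = ?q \<and> z = z}"
    unfolding eq[symmetric] chain_law_visited[of K z "\<lambda>y p. p = ?q \<and> y = z" n] .
  then show ?thesis by (simp add: measure_pmf_single pmf_positive_iff)
qed

text \<open>Given the word, the driven position is deterministic, so positive probability means
  certainty.\<close>

lemma chain_law_word_drive:
  fixes K :: "'z::countable \<Rightarrow> 'z pmf"
  assumes "\<P>(\<omega> in chain_law K z. R (aux_process f x n \<omega>) \<bar> \<omega> 0 = z \<and> (\<forall>j\<in>{1..n}. \<omega> j = w j)) > 0"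
  shows "R (drive f x z (map (\<lambda>i. w (Suc i)) [0..<n]))"
proof -
  have "0 < \<P>(\<omega> in chain_law K z. R (aux_process f x n \<omega>) \<and> \<omega> 0 = z \<and> (\<forall>j\<in>{1..n}. \<omega> j = w j))"
    using assms by (simp add: cond_prob_def zero_less_divide_iff)
  then have "{\<omega> \<in> space (chain_law K z). R (aux_process f x n \<omega>) \<and> \<omega> 0 = z \<and> (\<forall>j\<in>{1..n}. \<omega> j = w j)} \<noteq> {}"
    by (metis measure_empty order.irrefl)
  then obtain \<omega> where \<omega>: "R (aux_process f x n \<omega>)" "\<omega> 0 = z" "\<forall>j\<in>{1..n}. \<omega> j = w j" by blast
  then have "visited \<omega> n = map (\<lambda>i. w (Suc i)) [0..<n]" by (auto simp: visited_def)
  then show ?thesis using \<omega> by (simp add: aux_process_eq_drive)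
qed

theorem corollary1:
  fixes a b c :: real
    and f :: "real \<Rightarrow> 'z::countable \<Rightarrow> real"
    and K :: "'z \<Rightarrow> 'z pmf"
    and z\<^sub>0 :: 'z
    and N\<^sub>1 N\<^sub>2 :: nat
    and w\<^sub>1 w\<^sub>2 :: "nat \<Rightarrow> 'z"
    and M :: "'w measure"
    and X :: "nat \<Rightarrow> 'w \<Rightarrow> real"
    and Z :: "nat \<Rightarrow> 'w \<Rightarrow> 'z"
  assumes "a < b"
    and "case_prod f \<in> restrict_space borel {a..b} \<Otimes>\<^sub>M count_space UNIV \<rightarrow>\<^sub>M restrict_space borel {a..b}"
    and "\<forall>z. mono_on {a..b} (\<lambda>x. f x z)"
    and "markov_chain M K Z"
    and "X 0 \<in> borel_measurable M"
    and "\<forall>\<omega>\<in>space M. X 0 \<omega> \<in> {a..b}"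
    and "\<forall>t. \<forall>\<omega>\<in>space M. X (Suc t) \<omega> = f (X t \<omega>) (Z t \<omega>)"
    and "positive_recurrent_atom K z\<^sub>0"
    and "aperiodic_at K z\<^sub>0"
    and "a \<le> c" and "c \<le> b"
    and "0 < N\<^sub>1" and "0 < N\<^sub>2"
    and "w\<^sub>1 N\<^sub>1 = z\<^sub>0" and "w\<^sub>2 N\<^sub>2 = z\<^sub>0"
    and "\<P>(\<omega> in chain_law K z\<^sub>0. \<forall>j\<in>{1..N\<^sub>1}. \<omega> j = w\<^sub>1 j \<bar> \<omega> 0 = z\<^sub>0) > 0"
    and "\<P>(\<omega> in chain_law K z\<^sub>0. \<forall>j\<in>{1..N\<^sub>2}. \<omega> j = w\<^sub>2 j \<bar> \<omega> 0 = z\<^sub>0) > 0"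
    and "\<P>(\<omega> in chain_law K z\<^sub>0. aux_process f b N\<^sub>1 \<omega> \<le> c \<bar> \<omega> 0 = z\<^sub>0 \<and> (\<forall>j\<in>{1..N\<^sub>1}. \<omega> j = w\<^sub>1 j)) > 0"
    and "\<P>(\<omega> in chain_law K z\<^sub>0. aux_process f a N\<^sub>2 \<omega> \<ge> c \<bar> \<omega> 0 = z\<^sub>0 \<and> (\<forall>j\<in>{1..N\<^sub>2}. \<omega> j = w\<^sub>2 j)) > 0"
  shows "(\<exists>!\<mu>. real_distribution \<mu> \<and>
            (\<lambda>t. uniform_dist (distr M borel (X t)) \<mu>) \<longlonglongrightarrow> 0 \<and>
            (\<forall>x\<in>{a..b}. \<forall>z.
               (\<lambda>t. uniform_dist (distr (chain_law K z) borel (aux_process f x t)) \<mu>) \<longlonglongrightarrow> 0)) \<and>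
         (\<exists>(S :: (nat \<Rightarrow> real \<times> 'z) measure) Xs Zs.
            stationary_sequence S (borel \<Otimes>\<^sub>M count_space UNIV) (\<lambda>t s. (Xs t s, Zs t s)) \<and>
            (\<forall>t. \<forall>s\<in>space S. Xs t s \<in> {a..b}) \<and>
            (\<lambda>t. SUP x\<in>{a..b}. SUP B.
               \<bar>\<P>(\<omega> in M. X t \<omega> \<le> x \<and> Z t \<omega> \<in> B) - \<P>(s in S. Xs t s \<le> x \<and> Zs t s \<in> B)\<bar>) \<longlonglongrightarrow> 0)"
proof -
  note mc = assms(4)
  note f_meas = assms(2)
  have f_in: "f x z \<in> {a..b}" if "x \<in> {a..b}" for x z
    using measurable_space[OF f_meas, of "(x, z)"] that by (simp add: space_pair_measure space_restrict_space)
  define q1 where "q1 = map (\<lambda>i. w\<^sub>1 (Suc i)) [0..<N\<^sub>1]"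
  define q2 where "q2 = map (\<lambda>i. w\<^sub>2 (Suc i)) [0..<N\<^sub>2]"
  have q1: "q1 \<in> set_pmf (chain_path K N\<^sub>1 z\<^sub>0)" "last (z\<^sub>0 # q1) = z\<^sub>0" "drive f b z\<^sub>0 q1 \<le> c"
    unfolding q1_def using chain_law_word[OF assms(16)] chain_law_word_drive[OF assms(18)] assms(12,14)
    by (auto simp: last_map)
  have q2: "q2 \<in> set_pmf (chain_path K N\<^sub>2 z\<^sub>0)" "last (z\<^sub>0 # q2) = z\<^sub>0" "c \<le> drive f a z\<^sub>0 q2"
    unfolding q2_def using chain_law_word[OF assms(17)] chain_law_word_drive[OF assms(19)] assms(13,15)
    by (auto simp: last_map)
  interpret monotone_recursion K f a b z\<^sub>0
    using assms(1,3) f_in by unfold_locales (auto simp: mono_on_def)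
  \<comment> \<open>Whichever word comes last decides on which side of \<open>c\<close> the position ends up.\<close>
  interpret ergodic_recursion K f a b z\<^sub>0 c "N\<^sub>1 + N\<^sub>2" "q2 @ q1" "q1 @ q2"
  proof unfold_locales
    show "q1 @ q2 \<in> set_pmf (chain_path K (N\<^sub>1 + N\<^sub>2) z\<^sub>0)"
      unfolding path_add using q1 q2 by (force simp del: last.simps)
    show "q2 @ q1 \<in> set_pmf (chain_path K (N\<^sub>1 + N\<^sub>2) z\<^sub>0)"
      unfolding add.commute[of N\<^sub>1] path_add using q1 q2 by (force simp del: last.simps)
    show "last (z\<^sub>0 # q1 @ q2) = z\<^sub>0" "last (z\<^sub>0 # q2 @ q1) = z\<^sub>0"
      unfolding last_Cons_append q1(2) q2(2) by (rule refl)+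
    have "drive f b z\<^sub>0 (q2 @ q1) \<le> drive f b z\<^sub>0 q1"
      unfolding drive_append q2(2) using drive_in[OF b_in, of z\<^sub>0 q2] b_in by (intro drive_mono) auto
    then show "drive f b z\<^sub>0 (q2 @ q1) \<le> c" using q1(3) by linarith
    have "drive f a z\<^sub>0 q2 \<le> drive f a z\<^sub>0 (q1 @ q2)"
      unfolding drive_append q1(2) using drive_in[OF a_in, of z\<^sub>0 q1] a_in by (intro drive_mono) auto
    then show "c \<le> drive f a z\<^sub>0 (q1 @ q2)" using q2(3) by linarith
    show "c \<in> {a..b}" using assms(10,11) by simp
  qed (intro avoid_tendsto_0 summable_avoid Gcd_avoid assms(8,9))+
  obtain Q where Q: "prob_space Q" "sets Q = sets (borel \<Otimes>\<^sub>M count_space UNIV)"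
    and Q_limit: "\<And>y B. measure Q ({..y} \<times> B) = limit {..y} B"
    and Q_total: "\<And>B. measure Q (UNIV \<times> B) = limit {..b} B"
    using limit_law_exists by blast
  interpret Q: prob_space Q by (rule Q(1))
  have space_Q: "space Q = UNIV"
    using sets_eq_imp_space_eq[OF Q(2)] by (simp add: space_pair_measure)
  define \<mu> where "\<mu> = distr Q borel fst"
  have fst_Q: "fst \<in> Q \<rightarrow>\<^sub>M borel"
    unfolding measurable_cong_sets[OF Q(2) refl] by simp
  have \<mu>: "real_distribution \<mu>"
    unfolding \<mu>_def by (intro real_distribution.intro Q.prob_space_distr fst_Q real_distribution_axioms.intro) auto
  have cdf_\<mu>: "cdf \<mu> y = limit {..y} UNIV" for y
  proof -
    have "fst -` {..y} = {..y} \<times> (UNIV :: 'z set)" by auto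
    then show ?thesis
      unfolding cdf_def \<mu>_def using fst_Q by (simp add: measure_distr space_Q Q_limit)
  qed
  have X_meas: "X t \<in> borel_measurable M" for t
    by (rule recursion_measurable[of f a b Z M X, OF f_meas markov_chain_measurable[OF mc] assms(5)]) (use assms(6,7) in auto)
  have X_conv: "\<And>t. real_distribution (distr M borel (X t))" "(\<lambda>t. uniform_dist (distr M borel (X t)) \<mu>) \<longlonglongrightarrow> 0"
    using recursion_distribution_converges[of M Z X \<mu>, OF mc X_meas _ _ \<mu> cdf_\<mu>] assms(6,7) by auto
  have aux_conv: "(\<lambda>t. uniform_dist (distr (chain_law K z) borel (aux_process f x t)) \<mu>) \<longlonglongrightarrow> 0"
    if x: "x \<in> {a..b}" for x z
  proof -
    have zero: "aux_process f x 0 = (\<lambda>_. x)" by (rule ext) simp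
    have "aux_process f x t \<in> borel_measurable (chain_law K z)" for t
      by (rule recursion_measurable[of f a b "\<lambda>t \<omega>. \<omega> t" "chain_law K z" "aux_process f x",
            OF f_meas markov_chain_measurable[OF markov_chain_chain_law]]) (use x in \<open>simp_all add: zero\<close>)
    then show ?thesis
      using recursion_distribution_converges(2)[of "chain_law K z" "\<lambda>t \<omega>. \<omega> t" "aux_process f x" \<mu>,
          OF markov_chain_chain_law _ _ _ \<mu> cdf_\<mu>] x by simp
  qed
  have "\<exists>!\<mu>. real_distribution \<mu> \<and>
            (\<lambda>t. uniform_dist (distr M borel (X t)) \<mu>) \<longlonglongrightarrow> 0 \<and>
            (\<forall>x\<in>{a..b}. \<forall>z.
               (\<lambda>t. uniform_dist (distr (chain_law K z) borel (aux_process f x t)) \<mu>) \<longlonglongrightarrow> 0)"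
  proof (intro ex1I[of _ \<mu>] conjI ballI allI \<mu> X_conv(2) aux_conv)
    fix \<nu> assume "real_distribution \<nu> \<and>
            (\<lambda>t. uniform_dist (distr M borel (X t)) \<nu>) \<longlonglongrightarrow> 0 \<and>
            (\<forall>x\<in>{a..b}. \<forall>z.
               (\<lambda>t. uniform_dist (distr (chain_law K z) borel (aux_process f x t)) \<nu>) \<longlonglongrightarrow> 0)"
    then show "\<nu> = \<mu>"
      using uniform_dist_limit_unique[of "\<lambda>t. distr M borel (X t)", OF X_conv(1)] \<mu> X_conv(2) by blast
  qed
  moreover
  define N where "N = (borel :: real measure) \<Otimes>\<^sub>M (count_space UNIV :: 'z measure)"
  define S where "S = distr Q (Pi\<^sub>M UNIV (\<lambda>_::nat. N)) (\<lambda>q _. q)"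
  \<comment> \<open>The limit law puts full mass on \<open>[a, b]\<close>; clamping places every sample point there.\<close>
  define g :: "real \<times> 'z \<Rightarrow> real \<times> 'z" where "g q = (max a (min b (fst q)), snd q)" for q
  have g: "g \<in> N \<rightarrow>\<^sub>M N" unfolding N_def g_def by measurable
  have stat: "stationary_sequence S N (\<lambda>t s. g (s 0))"
    unfolding S_def by (rule constant_sequence_stationary(1)[OF Q(1) _ g]) (simp add: Q(2) N_def)
  have space_S: "space S = UNIV" by (simp add: S_def space_PiM N_def space_pair_measure)
  have S_limit: "\<P>(s in S. fst (g (s 0)) \<le> x \<and> snd (g (s 0)) \<in> B) = limit {..x} B" if x: "x \<in> {a..b}" for x B
  proof -
    \<comment> \<open>Clamping leaves \<open>fst q \<le> x\<close> unchanged for \<open>x < b\<close> and makes it void at \<open>x = b\<close>.\<close>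
    define A where "A = (if x = b then UNIV else {..x}) \<times> B"
    have "{s \<in> space S. fst (g (s 0)) \<le> x \<and> snd (g (s 0)) \<in> B} = {s \<in> space (Pi\<^sub>M UNIV (\<lambda>_::nat. N)). s 0 \<in> A}"
      using x by (auto simp: A_def g_def S_def mem_Times_iff max_def min_def split: if_splits)
    moreover have "A \<in> sets N" unfolding A_def N_def by (intro pair_measureI) auto
    ultimately have "\<P>(s in S. fst (g (s 0)) \<le> x \<and> snd (g (s 0)) \<in> B) = measure Q A"
      using constant_sequence_stationary(2)[OF Q(1) _ g, of A] unfolding S_def by (simp add: Q(2) N_def)
    then show ?thesis by (simp add: A_def Q_limit Q_total)
  qed
  obtain \<kappa> where \<kappa>: "\<kappa> \<longlonglongrightarrow> 0"
    and bound: "\<And>t y B. \<bar>\<P>(\<omega> in M. X t \<omega> \<le> y \<and> Z t \<omega> \<in> B) - limit {..y} B\<bar> \<le> \<kappa> t"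
    using recursion_converges[of M Z X, OF mc X_meas] assms(6,7) by blast
  have "(\<lambda>t. SUP x\<in>{a..b}. SUP B.
      \<bar>\<P>(\<omega> in M. X t \<omega> \<le> x \<and> Z t \<omega> \<in> B) - \<P>(s in S. fst (g (s 0)) \<le> x \<and> snd (g (s 0)) \<in> B)\<bar>) \<longlonglongrightarrow> 0"
    by (rule SUP_SUP_tendsto_0[OF _ \<kappa>]) (use assms(1) bound S_limit in auto)
  moreover have "\<forall>s\<in>space S. fst (g (s 0)) \<in> {a..b}" using assms(1) by (auto simp: g_def)
  ultimately show ?thesis
    using stat unfolding N_def
    by (intro conjI exI[of _ S] exI[of _ "\<lambda>_ s. fst (g (s 0))"] exI[of _ "\<lambda>_ s. snd (g (s 0))"]) simp_all
qed

end
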